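(* For sufficiently small constant $\epsilon>0$, $\mathrm{instopt}(H_{r,d},\epsilon,1/10)=\Omega(\sqrt{d})$ bits in the insertion-only streaming model.
   Context: The hubs graph $H_{r,d}$ consists of $r$ disjoint copies of the following graph: a single vertex which participates in $d$ edge-disjoint triangles. In the insertion-only model the edges of the input graph arrive in arbitrary order and are never deleted; cost is space in bits. An algorithm solves $G$ with $S$ space and $(\epsilon,\delta)$ error if, for every graph $G'$ isomorphic to some subgraph of $G$, given $G'$ as input it returns a value in $T(G')\pm\epsilon T(G)$ with probability at least $1-\delta$ using at most $S$ space, where $T(H)$ is the number of triangles of $H$. $\mathrm{instopt}(G,\epsilon,\delta)$ is the least such $S$ over all algorithms. *)

theory Defs
  imports "HOL-Probability.Probability_Mass_Function"
begin

type_synonym 'a graph = "'a set \<times> 'a set set"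

abbreviation verts :: "'a graph \<Rightarrow> 'a set" where "verts \<equiv> fst"
abbreviation edges :: "'a graph \<Rightarrow> 'a set set" where "edges \<equiv> snd"

definition simple_graph :: "'a graph \<Rightarrow> bool" where
  "simple_graph G \<longleftrightarrow> finite (verts G) \<and> (\<forall>e\<in>edges G. e \<subseteq> verts G \<and> card e = 2)"

definition subgraph :: "'a graph \<Rightarrow> 'a graph \<Rightarrow> bool" where
  "subgraph H G \<longleftrightarrow> simple_graph H \<and> verts H \<subseteq> verts G \<and> edges H \<subseteq> edges G"

definition graph_iso :: "'a graph \<Rightarrow> 'b graph \<Rightarrow> bool" where
  "graph_iso G H \<longleftrightarrow>
     (\<exists>f. bij_betw f (verts G) (verts H) \<and> edges H = (\<lambda>e. f ` e) ` edges G)"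

definition triangles :: "'a graph \<Rightarrow> nat" where
  "triangles G = card {t. t \<subseteq> verts G \<and> card t = 3 \<and>
     (\<forall>u\<in>t. \<forall>v\<in>t. u \<noteq> v \<longrightarrow> {u, v} \<in> edges G)}"

text \<open>\<open>Hub i\<close> is the central vertex of the \<open>i\<close>-th copy; \<open>Rim i j False\<close> and \<open>Rim i j True\<close> are
  the other two vertices of its \<open>j\<close>-th triangle. Edge-disjoint triangles through a common vertex
  have no other vertex in common.\<close>

datatype hub_vertex = Hub nat | Rim nat nat bool

definition hubs_graph :: "nat \<Rightarrow> nat \<Rightarrow> hub_vertex graph" where
  "hubs_graph r d =
     (Hub ` {..<r} \<union> {Rim i j b | i j b. i < r \<and> j < d},
      {{Hub i, Rim i j b} | i j b. i < r \<and> j < d} \<union>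
      {{Rim i j False, Rim i j True} | i j. i < r \<and> j < d})"

text \<open>Vertices of input graphs are labelled by natural numbers, and the memory content between two
  stream elements is a bit string.\<close>

record stream_alg =
  init :: "bool list"
  update :: "bool list \<Rightarrow> nat set \<Rightarrow> bool list"
  estimate :: "bool list \<Rightarrow> real"

definition memory_after :: "stream_alg \<Rightarrow> nat set list \<Rightarrow> bool list" where
  "memory_after A es = foldl (update A) (init A) es"

definition answer :: "stream_alg \<Rightarrow> nat set list \<Rightarrow> real" where
  "answer A es = estimate A (memory_after A es)"

definition space_used :: "stream_alg \<Rightarrow> nat set list \<Rightarrow> nat" where
  "space_used A es = Max ((\<lambda>k. length (memory_after A (take k es))) ` {..length es})"

text \<open>An insertion-only stream presents every edge exactly once, in any order.\<close>

definition insertion_stream :: "nat graph \<Rightarrow> nat set list \<Rightarrow> bool" where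
  "insertion_stream G es \<longleftrightarrow> distinct es \<and> set es = edges G"

text \<open>The labels of an input \<open>G'\<close> come from the universe \<open>{0, ..., n - 1}\<close>, where \<open>n\<close> is the
  number of vertices of \<open>G\<close>.\<close>

definition admissible_input :: "'a graph \<Rightarrow> nat graph \<Rightarrow> bool" where
  "admissible_input G G' \<longleftrightarrow>
     verts G' \<subseteq> {..<card (verts G)} \<and> (\<exists>H. subgraph H G \<and> graph_iso H G')"

text \<open>A randomized algorithm is a probability distribution over deterministic ones, so that access
  to random bits is not charged as space. This subsumes algorithms that toss fresh coins at every
  update, since no edge occurs twice in a stream. The space bound holds for every
  outcome of the coin tosses.\<close>

definition solves :: "stream_alg pmf \<Rightarrow> 'a graph \<Rightarrow> nat \<Rightarrow> real \<Rightarrow> real \<Rightarrow> bool" where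
  "solves P G S \<epsilon> \<delta> \<longleftrightarrow>
     (\<forall>G' es. admissible_input G G' \<and> insertion_stream G' es \<longrightarrow>
        measure_pmf.prob P
          {A. \<bar>answer A es - real (triangles G')\<bar> \<le> \<epsilon> * real (triangles G)} \<ge> 1 - \<delta> \<and>
        (\<forall>A\<in>set_pmf P. space_used A es \<le> S))"

definition instopt :: "'a graph \<Rightarrow> real \<Rightarrow> real \<Rightarrow> nat" where
  "instopt G \<epsilon> \<delta> = (LEAST S. \<exists>P. solves P G S \<epsilon> \<delta>)"

end

(* A low-space algorithm would give a one-way protocol with short messages for Boolean Hidden
   Matching. Alice holds a subset Z of 2n coordinates, which she encodes as star edges by joining the
   hub of every copy to one of two twin leaves per coordinate. Bob holds a random partial matching
   between two halves of the coordinates and one bit per matching edge; two edges between the twins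
   of each matched pair close a triangle with the hub exactly when the bit is the parity of Z on the
   pair. So the correct bits give r k triangles for k matching edges, the flipped bits none.

   Given Alice's message, the parities are nearly uniform: reveal them one by one and bound the
   relative entropy by the chain rule. One step costs the average squared bias of a random pair,
   which by the level-two inequality is O((1 - ln mu)^2 / n^2) for a density bounded by 1 of mean mu.
   Only the unmatched coordinates are kept, so the density stays bounded by 1, and mu (1 - ln mu)^2
   is concave in mu, so conditioning on parities and messages does not increase this cost. The total
   is O(S^2 / n) for S bits of space. *)

theory Submission
  imports Defs
begin

section \<open>Exponential moments and the level-two inequality\<close>

text \<open>The square root in the bound stems from the squared logarithm: a message of S bits
  typically leaves a density of mean about 2^-S, its level-two weight relative to its mass carries
  (ln mu)^2, and this is divided by the number of available pairs and paid k times. The matching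
  must be linear in d, because the permitted error can reach epsilon r d while the two cases differ
  by r k triangles; this also fixes what a small epsilon is. On the other hand a long matching
  exhausts the coordinates, so it uses at most half of each side and every revelation still averages
  over order n^2 pairs. The obstacle on the graph side is that the correct and the flipped bits must
  both give subgraphs of the hubs graph up to isomorphism, although the added edges join leaves of
  different coordinates. Having two leaves per coordinate and two edges per pair solves this:
  exchanging one leaf of each matched pair turns these edges into genuine rim edges. Relative
  entropy becomes distinguishing advantage through a pointwise Hellinger-type inequality, which can
  be summed over messages of very different probability.\<close>

definition mean :: "'a set \<Rightarrow> ('a \<Rightarrow> real) \<Rightarrow> real" where
  "mean S f = sum f S / real (card S)"

lemma mean_cong: "(\<And>x. x \<in> S \<Longrightarrow> f x = g x) \<Longrightarrow> mean S f = mean S g"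
  by (simp add: mean_def)

lemma mean_mono: "(\<And>x. x \<in> S \<Longrightarrow> f x \<le> g x) \<Longrightarrow> mean S f \<le> mean S g"
  by (simp add: mean_def divide_right_mono sum_mono)

lemma mean_nonneg: "(\<And>x. x \<in> S \<Longrightarrow> 0 \<le> f x) \<Longrightarrow> 0 \<le> mean S f"
  by (simp add: mean_def sum_nonneg)

lemma mean_const: "finite S \<Longrightarrow> S \<noteq> {} \<Longrightarrow> mean S (\<lambda>_. c) = c"
  by (simp add: mean_def)

lemma mean_add: "mean S (\<lambda>x. f x + g x) = mean S f + mean S g"
  by (simp add: mean_def sum.distrib add_divide_distrib)

lemma mean_diff: "mean S (\<lambda>x. f x - g x) = mean S f - mean S g"
  by (simp add: mean_def sum_subtractf diff_divide_distrib)

lemma mean_cmult: "mean S (\<lambda>x. c * f x) = c * mean S f"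
  by (simp add: mean_def sum_distrib_left)

lemma mean_sum: "mean S (\<lambda>x. \<Sum>i\<in>I. f i x) = (\<Sum>i\<in>I. mean S (f i))"
  unfolding mean_def by (subst sum.swap) (simp add: sum_divide_distrib)

lemma mean_Times: "mean (S \<times> T) f = mean S (\<lambda>x. mean T (\<lambda>y. f (x, y)))"
  unfolding mean_def
  by (simp add: sum.cartesian_product sum_divide_distrib[symmetric] card_cartesian_product mult.commute)

lemma mean_bij_betw: "bij_betw h S T \<Longrightarrow> mean T f = mean S (\<lambda>x. f (h x))"
  unfolding mean_def by (simp add: sum.reindex_bij_betw bij_betw_same_card)

lemma mean_image: "inj_on h S \<Longrightarrow> mean (h ` S) f = mean S (\<lambda>x. f (h x))"
  by (simp add: inj_on_imp_bij_betw mean_bij_betw)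

lemma mean_bool: "mean UNIV f = (f True + f False) / 2"
  by (simp add: mean_def UNIV_bool)

lemma mean_Pow_Un:
  assumes "finite A" "finite B" "A \<inter> B = {}"
  shows "mean (Pow (A \<union> B)) f = mean (Pow A) (\<lambda>X. mean (Pow B) (\<lambda>Y. f (X \<union> Y)))"
proof -
  have inj: "inj_on (\<lambda>(X, Y). X \<union> Y) (Pow A \<times> Pow B)"
  proof (rule inj_on_inverseI)
    fix p assume "p \<in> Pow A \<times> Pow B"
    then show "(\<lambda>Z. (Z \<inter> A, Z \<inter> B)) ((\<lambda>(X, Y). X \<union> Y) p) = p"
      using assms(3) by auto
  qed
  have img: "(\<lambda>(X, Y). X \<union> Y) ` (Pow A \<times> Pow B) = Pow (A \<union> B)"
  proof (intro equalityI subsetI)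
    fix Z assume "Z \<in> Pow (A \<union> B)"
    then have "Z = (\<lambda>(X, Y). X \<union> Y) (Z \<inter> A, Z \<inter> B)" by auto
    then show "Z \<in> (\<lambda>(X, Y). X \<union> Y) ` (Pow A \<times> Pow B)" by blast
  qed auto
  show ?thesis
    unfolding img[symmetric] mean_image[OF inj] mean_Times by simp
qed

lemma mean_Pow_insert:
  assumes "finite A" "u \<notin> A"
  shows "mean (Pow (insert u A)) f = mean (Pow A) (\<lambda>Z. (f Z + f (insert u Z)) / 2)"
proof -
  have "mean (Pow (A \<union> {u})) f = mean (Pow A) (\<lambda>X. mean (Pow {u}) (\<lambda>Y. f (X \<union> Y)))"
    using assms by (intro mean_Pow_Un) auto
  also have "\<dots> = mean (Pow A) (\<lambda>Z. (f Z + f (insert u Z)) / 2)"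
    by (intro mean_cong) (simp add: mean_def Pow_insert add.commute)
  finally show ?thesis by simp
qed

section \<open>Random signs: exponential moments and level-two Fourier weight\<close>

definition sign :: "'a \<Rightarrow> 'a set \<Rightarrow> real" where
  "sign u Z = (if u \<in> Z then 1 else -1)"

text \<open>For nonnegative t the function exp(-t^2/2) cosh t decreases from 1, since its derivative
  has the sign of sinh t - t cosh t; evenness covers negative x. This is the sub-Gaussian bound for
  a single random sign.\<close>

lemma cosh_le_exp_square: "cosh (x::real) \<le> exp (x\<^sup>2 / 2)"
proof -
  have *: "cosh x \<le> exp (x\<^sup>2 / 2)" if "x \<ge> 0" for x :: real
  proof -
    have sinh_le: "sinh y \<le> y * cosh y" if "y \<ge> 0" for y :: real
    proof -
      have "(\<lambda>t. t * cosh t - sinh t) 0 \<le> (\<lambda>t. t * cosh t - sinh t) y"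
      proof (rule DERIV_nonneg_imp_nondecreasing[OF that])
        fix t :: real assume "0 \<le> t"
        then show "\<exists>D. ((\<lambda>t. t * cosh t - sinh t) has_real_derivative D) (at t) \<and> D \<ge> 0"
          by (intro exI[of _ "t * sinh t"]) (auto intro!: derivative_eq_intros)
      qed
      then show ?thesis by simp
    qed
    have "(\<lambda>t. exp (- t\<^sup>2 / 2) * cosh t) x \<le> (\<lambda>t. exp (- t\<^sup>2 / 2) * cosh t) 0"
    proof (rule DERIV_nonpos_imp_nonincreasing[OF that])
      fix t :: real assume "0 \<le> t"
      then show "\<exists>D. ((\<lambda>t. exp (- t\<^sup>2 / 2) * cosh t) has_real_derivative D) (at t) \<and> D \<le> 0"
        using sinh_le[of t]
        by (intro exI[of _ "exp (- t\<^sup>2 / 2) * (sinh t - t * cosh t)"])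
          (auto intro!: derivative_eq_intros mult_nonneg_nonpos simp: algebra_simps)
    qed
    then show ?thesis by (simp add: exp_minus field_simps)
  qed
  show ?thesis using *[of "\<bar>x\<bar>"] by (cases "x \<ge> 0") auto
qed

lemma mean_exp_linear_le:
  assumes "finite R"
  shows "mean (Pow R) (\<lambda>Y. exp (\<Sum>v\<in>R. c v * sign v Y)) \<le> exp (\<Sum>v\<in>R. (c v)\<^sup>2 / 2)"
  using assms
proof (induction R)
  case empty
  then show ?case by (simp add: mean_def)
next
  case (insert v R)
  have sums: "(\<Sum>w\<in>R. c w * sign w (insert v Y)) = (\<Sum>w\<in>R. c w * sign w Y)" for Y
    using insert by (intro sum.cong) (auto simp: sign_def)
  have "mean (Pow (insert v R)) (\<lambda>Y. exp (\<Sum>w\<in>insert v R. c w * sign w Y))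
    = mean (Pow R) (\<lambda>Y. cosh (c v) * exp (\<Sum>w\<in>R. c w * sign w Y))"
    unfolding mean_Pow_insert[OF insert(1,2)] sum.insert[OF insert(1,2)] sums
    using insert(2)
    by (intro mean_cong) (auto simp: sign_def exp_add cosh_def algebra_simps add_divide_distrib)
  also have "\<dots> \<le> exp ((c v)\<^sup>2 / 2) * exp (\<Sum>w\<in>R. (c w)\<^sup>2 / 2)"
    unfolding mean_cmult
    by (intro mult_mono cosh_le_exp_square insert.IH mean_nonneg) auto
  also have "\<dots> = exp (\<Sum>w\<in>insert v R. (c w)\<^sup>2 / 2)"
    using insert by (simp add: exp_add)
  finally show ?case .
qed

text \<open>Averaging over one sign turns the cross term into a cosh, and Cauchy-Schwarz bounds this
  by an exponential of the same squared norm without that sign, at the price of a larger parameter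
  \<open>t'\<close>. Hence the induction generalises over \<open>t\<close>, and the fraction in the
  exponent is chosen so that it survives the change of parameter.\<close>

lemma mean_exp_norm_square_le:
  fixes a :: "'a \<Rightarrow> 'b \<Rightarrow> real"
  assumes "finite L" "t > 0" "2 * t * (\<Sum>u\<in>L. \<Sum>v\<in>R. (a u v)\<^sup>2) < 1"
  shows "mean (Pow L) (\<lambda>X. exp (t * (\<Sum>v\<in>R. (c v + (\<Sum>u\<in>L. a u v * sign u X))\<^sup>2)))
    \<le> exp (((\<Sum>u\<in>L. \<Sum>v\<in>R. (a u v)\<^sup>2) + (\<Sum>v\<in>R. (c v)\<^sup>2)) * t
        / (1 - 2 * t * (\<Sum>u\<in>L. \<Sum>v\<in>R. (a u v)\<^sup>2)))"
  using assms
proof (induction L arbitrary: t c)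
  case empty
  then show ?case by (simp add: mean_def mult.commute)
next
  case (insert u L)
  define s where "s = (\<Sum>w\<in>L. \<Sum>v\<in>R. (a w v)\<^sup>2)"
  define q where "q = (\<Sum>v\<in>R. (a u v)\<^sup>2)"
  define lin where "lin X v = c v + (\<Sum>w\<in>L. a w v * sign w X)" for X v
  define t' where "t' = t * (1 + 2 * t * q)"
  have q0: "q \<ge> 0" and s0: "s \<ge> 0" by (auto simp: q_def s_def sum_nonneg)
  have tot: "(\<Sum>w\<in>insert u L. \<Sum>v\<in>R. (a w v)\<^sup>2) = q + s"
    using insert by (simp add: q_def s_def)
  have lt: "2 * t * (q + s) < 1" using insert.prems(2) tot by simp
  have t0: "t > 0" by fact
  have t'0: "t' > 0" using t0 q0 by (auto simp: t'_def intro!: mult_pos_pos add_pos_nonneg)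
  \<comment> \<open>In reciprocals: 1/t' = 1/t - 2q/(1 + 2tq) is at least 1/t - 2q. So removing a
    vector of squared length q lowers 1/t by at most the 2q that the remaining weight loses.\<close>
  have key: "t' * (1 - 2 * t * (q + s)) \<le> t * (1 - 2 * t' * s)"
  proof -
    have "t * (1 - 2 * t' * s) - t' * (1 - 2 * t * (q + s)) = 4 * t * t * t * q * q"
      by (simp add: t'_def algebra_simps)
    moreover have "0 \<le> 4 * t * t * t * q * q" using t0 q0 by simp
    ultimately show ?thesis by linarith
  qed
  have lt': "2 * t' * s < 1"
  proof -
    have "0 < t' * (1 - 2 * t * (q + s))" using t'0 lt by simp
    then have "0 < t * (1 - 2 * t' * s)" using key by linarith
    then show ?thesis using t0 by (simp add: zero_less_mult_iff)
  qed
  have step: "(exp (t * (\<Sum>v\<in>R. (lin X v - a u v)\<^sup>2)) + exp (t * (\<Sum>v\<in>R. (lin X v + a u v)\<^sup>2))) / 2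
      \<le> exp (t * q) * exp (t' * (\<Sum>v\<in>R. (lin X v)\<^sup>2))" for X
  proof -
    define p where "p = (\<Sum>v\<in>R. lin X v * a u v)"
    define l where "l = (\<Sum>v\<in>R. (lin X v)\<^sup>2)"
    have e1: "(\<Sum>v\<in>R. (lin X v - a u v)\<^sup>2) = l + q - 2 * p"
      by (simp add: l_def q_def p_def power2_eq_square algebra_simps sum.distrib sum_subtractf
          sum_distrib_left)
    have e2: "(\<Sum>v\<in>R. (lin X v + a u v)\<^sup>2) = l + q + 2 * p"
      by (simp add: l_def q_def p_def power2_eq_square algebra_simps sum.distrib sum_distrib_left)
    have "(exp (t * (l + q - 2 * p)) + exp (t * (l + q + 2 * p))) / 2
        = exp (t * (l + q)) * cosh (2 * t * p)"
    proof -
      have "t * (l + q - 2 * p) = t * (l + q) + - (2 * t * p)" "t * (l + q + 2 * p) = t * (l + q) + 2 * t * p"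
        by (simp_all add: algebra_simps)
      then show ?thesis by (simp only: cosh_def exp_add) (simp add: distrib_left)
    qed
    also have "\<dots> \<le> exp (t * (l + q)) * exp ((2 * t * p)\<^sup>2 / 2)"
      by (intro mult_left_mono cosh_le_exp_square) simp
    also have "\<dots> \<le> exp (t * (l + q)) * exp (2 * t\<^sup>2 * (l * q))"
    proof -
      have "p\<^sup>2 \<le> l * q" unfolding p_def l_def q_def by (rule Cauchy_Schwarz_ineq_sum)
      then have "2 * t\<^sup>2 * p\<^sup>2 \<le> 2 * t\<^sup>2 * (l * q)" by (intro mult_left_mono) auto
      then show ?thesis by (simp add: power_mult_distrib mult_ac)
    qed
    also have "\<dots> = exp (t * q) * exp (t' * l)"
      by (simp add: t'_def algebra_simps power2_eq_square flip: exp_add)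
    finally show ?thesis by (simp add: e1 e2 l_def)
  qed
  have sums: "(\<Sum>w\<in>L. a w v * sign w (insert u X)) = (\<Sum>w\<in>L. a w v * sign w X)" for X v
    using insert by (intro sum.cong) (auto simp: sign_def)
  have "mean (Pow (insert u L)) (\<lambda>X. exp (t * (\<Sum>v\<in>R. (c v + (\<Sum>w\<in>insert u L. a w v * sign w X))\<^sup>2)))
    = mean (Pow L) (\<lambda>X. (exp (t * (\<Sum>v\<in>R. (lin X v - a u v)\<^sup>2)) + exp (t * (\<Sum>v\<in>R. (lin X v + a u v)\<^sup>2))) / 2)"
    unfolding mean_Pow_insert[OF insert(1,2)] sum.insert[OF insert(1,2)] sums
    using insert(2) by (intro mean_cong) (auto simp: sign_def lin_def algebra_simps)
  also have "\<dots> \<le> exp (t * q) * mean (Pow L) (\<lambda>X. exp (t' * (\<Sum>v\<in>R. (lin X v)\<^sup>2)))"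
    unfolding mean_cmult[symmetric] by (intro mean_mono step)
  also have "\<dots> \<le> exp (t * q) * exp ((s + (\<Sum>v\<in>R. (c v)\<^sup>2)) * t' / (1 - 2 * t' * s))"
    using insert.IH[OF t'0, of c] lt' by (intro mult_left_mono) (auto simp: s_def lin_def)
  also have "\<dots> \<le> exp ((q + s + (\<Sum>v\<in>R. (c v)\<^sup>2)) * t / (1 - 2 * t * (q + s)))"
  proof -
    define k where "k = t / (1 - 2 * t * (q + s))"
    have "t' / (1 - 2 * t' * s) \<le> k"
      using key lt lt' unfolding k_def by (simp add: field_simps)
    moreover have "t \<le> k"
    proof -
      have "t * (1 - 2 * t * (q + s)) \<le> t * 1"
        using t0 q0 s0 by (intro mult_left_mono) auto
      then show ?thesis using lt unfolding k_def by (simp add: field_simps)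
    qed
    ultimately have "t * q + (s + (\<Sum>v\<in>R. (c v)\<^sup>2)) * (t' / (1 - 2 * t' * s))
        \<le> k * q + (s + (\<Sum>v\<in>R. (c v)\<^sup>2)) * k"
      using q0 s0 by (intro add_mono mult_right_mono mult_left_mono add_nonneg_nonneg sum_nonneg) auto
    then show ?thesis by (simp add: k_def algebra_simps add_divide_distrib flip: exp_add)
  qed
  finally show ?case unfolding tot .
qed

text \<open>Let Q be the bilinear form in the signs whose coefficients are the correlations, scaled
  to norm 1; its correlation with \<open>g\<close> is then the norm \<beta> to be bounded. Given the
  signs on \<open>L\<close>, the form is linear in those on \<open>R\<close>, so the two moment
  bounds apply in turn and exp(Q/2) has mean at most e. A density at most 1 and of mean \<mu>
  therefore cannot make Q/2 larger than 1 - ln \<mu> on average.\<close>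

lemma level_two_inequality:
  assumes fin: "finite L" "finite R" "L \<inter> R = {}"
    and g: "\<And>Z. 0 \<le> g Z" "\<And>Z. g Z \<le> 1"
    and mu: "\<mu> = mean (Pow (L \<union> R)) g" "\<mu> > 0"
  shows "(\<Sum>u\<in>L. \<Sum>v\<in>R. (mean (Pow (L \<union> R)) (\<lambda>Z. g Z * (sign u Z * sign v Z)))\<^sup>2)
    \<le> 4 * (\<mu> * (1 - ln \<mu>))\<^sup>2"
proof -
  let ?E = "mean (Pow (L \<union> R))"
  define b where "b u v = ?E (\<lambda>Z. g Z * (sign u Z * sign v Z))" for u v
  define B where "B = (\<Sum>u\<in>L. \<Sum>v\<in>R. (b u v)\<^sup>2)"
  define \<beta> where "\<beta> = sqrt B"
  have finP: "finite (Pow (L \<union> R))" "Pow (L \<union> R) \<noteq> {}" using fin by auto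
  have mu1: "\<mu> \<le> 1"
    using mean_mono[of "Pow (L \<union> R)" g "\<lambda>_. 1"] g finP by (simp add: mu mean_const)
  have B0: "B \<ge> 0" by (auto simp: B_def sum_nonneg)
  have B\<beta>: "B = \<beta>\<^sup>2" using B0 by (simp add: \<beta>_def)
  have \<beta>_le: "\<beta> \<le> 2 * (\<mu> * (1 - ln \<mu>))"
  proof (cases "B = 0")
    case True
    then show ?thesis using mu(2) mu1 ln_le_minus_one[of \<mu>] by (auto simp: \<beta>_def intro!: mult_nonneg_nonneg)
  next
    case False
    then have \<beta>0: "\<beta> > 0" using B0 by (simp add: \<beta>_def)
    define a where "a u v = b u v / \<beta>" for u v
    define Q where "Q Z = (\<Sum>u\<in>L. \<Sum>v\<in>R. a u v * (sign u Z * sign v Z))" for Z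
    have asum: "(\<Sum>u\<in>L. \<Sum>v\<in>R. (a u v)\<^sup>2) = 1"
      using \<beta>0 B\<beta> unfolding a_def power_divide by (simp flip: sum_divide_distrib B_def)
    have EQ: "?E (\<lambda>Z. g Z * Q Z) = \<beta>"
    proof -
      have "?E (\<lambda>Z. g Z * Q Z) = ?E (\<lambda>Z. \<Sum>u\<in>L. \<Sum>v\<in>R. a u v * (g Z * (sign u Z * sign v Z)))"
        unfolding Q_def sum_distrib_left by (intro mean_cong sum.cong) (auto simp: algebra_simps)
      also have "\<dots> = (\<Sum>u\<in>L. \<Sum>v\<in>R. a u v * b u v)"
        unfolding mean_sum mean_cmult b_def ..
      also have "\<dots> = (\<Sum>u\<in>L. \<Sum>v\<in>R. (b u v)\<^sup>2) / \<beta>"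
        by (simp add: a_def power2_eq_square flip: sum_divide_distrib)
      also have "\<dots> = \<beta>\<^sup>2 / \<beta>" by (simp add: B\<beta>[symmetric] B_def)
      also have "\<dots> = \<beta>" using \<beta>0 by (simp add: power2_eq_square)
      finally show ?thesis .
    qed
    have moment: "?E (\<lambda>Z. exp (Q Z / 2)) \<le> exp 1"
    proof -
      have "?E (\<lambda>Z. exp (Q Z / 2)) = mean (Pow L) (\<lambda>X. mean (Pow R) (\<lambda>Y. exp (Q (X \<union> Y) / 2)))"
        by (rule mean_Pow_Un[OF fin])
      also have "\<dots> = mean (Pow L) (\<lambda>X. mean (Pow R) (\<lambda>Y. exp (\<Sum>v\<in>R. ((\<Sum>u\<in>L. a u v * sign u X) / 2) * sign v Y)))"
      proof (intro mean_cong arg_cong[where f = exp])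
        fix X Y assume XY: "X \<in> Pow L" "Y \<in> Pow R"
        have "Q (X \<union> Y) = (\<Sum>u\<in>L. \<Sum>v\<in>R. a u v * (sign u X * sign v Y))"
          unfolding Q_def using XY fin(3) by (intro sum.cong) (auto simp: sign_def)
        then show "Q (X \<union> Y) / 2 = (\<Sum>v\<in>R. ((\<Sum>u\<in>L. a u v * sign u X) / 2) * sign v Y)"
          by (subst (asm) sum.swap) (simp add: sum_divide_distrib sum_distrib_right mult.assoc)
      qed
      also have "\<dots> \<le> mean (Pow L) (\<lambda>X. exp (\<Sum>v\<in>R. ((\<Sum>u\<in>L. a u v * sign u X) / 2)\<^sup>2 / 2))"
        by (intro mean_mono mean_exp_linear_le fin)
      also have "\<dots> = mean (Pow L) (\<lambda>X. exp ((1/8) * (\<Sum>v\<in>R. (0 + (\<Sum>u\<in>L. a u v * sign u X))\<^sup>2)))"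
        by (simp add: power_divide flip: sum_divide_distrib)
      \<comment> \<open>With parameter 1/8 and total weight 1 the exponent is 1/6. Its cruder bound
        1 becomes the 1 in 1 - ln \<mu>.\<close>
      also have "\<dots> \<le> exp ((1 + (\<Sum>v\<in>R. 0\<^sup>2)) * (1/8) / (1 - 2 * (1/8) * 1))"
        using mean_exp_norm_square_le[of L "1/8" a R "\<lambda>_. 0"] fin by (simp add: asum)
      also have "\<dots> \<le> exp 1" by simp
      finally show ?thesis .
    qed
    \<comment> \<open>This is the average of Q/2 under the normalised density g/\<mu>. The tangent
      of exp at this point loses nothing on average, which is Jensen's inequality in explicit
      form.\<close>
    define c where "c = \<beta> / (2 * \<mu>)"
    have "exp c * \<mu> = ?E (\<lambda>Z. exp c * ((1 - c) * g Z + (1/2) * (g Z * Q Z)))"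
      unfolding mean_cmult mean_add EQ mu(1)[symmetric] using mu(2) by (simp add: c_def field_simps)
    also have "\<dots> \<le> ?E (\<lambda>Z. exp (Q Z / 2))"
    proof (rule mean_mono)
      fix Z
      have "exp c * ((1 - c) * g Z + (1/2) * (g Z * Q Z)) = g Z * (exp c * (1 + (Q Z / 2 - c)))"
        by (simp add: algebra_simps)
      also have "\<dots> \<le> g Z * (exp c * exp (Q Z / 2 - c))"
        by (intro mult_left_mono exp_ge_add_one_self g) auto
      also have "\<dots> = g Z * exp (Q Z / 2)" by (simp flip: exp_add)
      also have "\<dots> \<le> 1 * exp (Q Z / 2)" by (intro mult_right_mono g) auto
      finally show "exp c * ((1 - c) * g Z + (1/2) * (g Z * Q Z)) \<le> exp (Q Z / 2)" by simp
    qed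
    also note moment
    finally have "exp c * \<mu> \<le> exp 1" .
    then have "ln (exp c * \<mu>) \<le> ln (exp 1)" using mu(2) by (subst ln_le_cancel_iff) auto
    then have "c \<le> 1 - ln \<mu>" using mu(2) by (simp add: ln_mult)
    then show ?thesis using mu(2) by (simp add: c_def field_simps)
  qed
  have "B \<le> (2 * (\<mu> * (1 - ln \<mu>)))\<^sup>2"
    unfolding B\<beta> using \<beta>_le B0 by (intro power_mono) (auto simp: \<beta>_def)
  then show ?thesis unfolding B_def b_def by (simp add: power_mult_distrib)
qed

section \<open>Concavity of the revelation cost, and entropy inequalities\<close>

definition phi :: "real \<Rightarrow> real" where
  "phi x = x * (1 - ln x)\<^sup>2"

definition ent :: "real \<Rightarrow> real" where
  "ent x = x * ln x"

lemma exp_minus_ge: "exp (-z) - 1 + z \<ge> z\<^sup>2 / (2 * (1 + z))" if "z \<ge> 0" for z :: real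
proof -
  \<comment> \<open>The difference of the two sides, with z^2/(1 + z) expanded as z - 1 + 1/(1 + z).
    Since exp(-t) is at most y = 1/(1 + t), the derivative is at least (1 - y)^2 / 2.\<close>
  define h where "h t = exp (-t) - 1/2 + t/2 - inverse (1 + t) / 2" for t :: real
  have "h 0 \<le> h z"
  proof (rule DERIV_nonneg_imp_nondecreasing[OF that])
    fix t :: real assume t: "0 \<le> t"
    define y where "y = 1 / (1 + t)"
    have d: "(h has_real_derivative (- exp (-t) + 1/2 + y\<^sup>2 / 2)) (at t)"
      unfolding h_def y_def using t
      by (auto intro!: derivative_eq_intros simp: power2_eq_square inverse_eq_divide)
        (auto simp: divide_simps algebra_simps add_nonneg_eq_0_iff)
    have "exp (-t) \<le> y"
      using t exp_ge_add_one_self[of t] by (simp add: y_def exp_minus field_simps)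
    moreover have "0 \<le> (1 - y)\<^sup>2" by simp
    ultimately have "0 \<le> - exp (-t) + 1/2 + y\<^sup>2 / 2"
      by (simp add: power2_eq_square algebra_simps)
    with d show "\<exists>D. (h has_real_derivative D) (at t) \<and> 0 \<le> D" by blast
  qed
  moreover have "h z = exp (-z) - 1 + z - z\<^sup>2 / (2 * (1 + z))"
    using that by (simp add: h_def field_simps power2_eq_square)
  ultimately show ?thesis by (simp add: h_def)
qed

text \<open>\<open>phi\<close> is the level-two bound divided by the mass, so up to a constant and
  the number of pairs it is the price of one parity. The right-hand side is its tangent at
  \<open>a\<close>, with slope (ln a)^2 - 1; this form of concavity includes x = 0. Dividing by x
  and setting \<delta> = ln a - ln x reduces it to \<delta>^2 \<le> 2 (1 - ln a) (exp \<delta> - 1 -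
  \<delta>). For negative \<delta> this needs -\<delta> \<le> -ln a, which holds because x is at
  most 1.\<close>

lemma phi_le_tangent:
  assumes x: "0 \<le> x" "x \<le> 1" and a: "0 < a" "a \<le> 1"
  shows "phi x \<le> ((ln a)\<^sup>2 - 1) * x + 2 * a * (1 - ln a)"
proof (cases "x = 0")
  case True
  then show ?thesis using a ln_le_minus_one[of a] by (auto simp: phi_def intro!: mult_nonneg_nonneg)
next
  case False
  then have x0: "x > 0" using x by simp
  define \<alpha> where "\<alpha> = ln a"
  define \<delta> where "\<delta> = \<alpha> - ln x"
  have \<alpha>0: "\<alpha> \<le> 0" using a by (simp add: \<alpha>_def)
  have lnx: "ln x \<le> 0" using x x0 by simp
  have ax: "a = x * exp \<delta>" using a x0 by (simp add: \<delta>_def \<alpha>_def exp_diff)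
  have "\<delta>\<^sup>2 / (2 * (1 - \<alpha>)) \<le> exp \<delta> - 1 - \<delta>"
  proof (cases "\<delta> \<ge> 0")
    case True
    have "\<delta>\<^sup>2 / (2 * (1 - \<alpha>)) \<le> \<delta>\<^sup>2 / 2" using \<alpha>0 by (intro divide_left_mono) auto
    then show ?thesis using exp_lower_Taylor_quadratic[OF True] by linarith
  next
    case False
    have "\<delta>\<^sup>2 / (2 * (1 - \<alpha>)) \<le> (-\<delta>)\<^sup>2 / (2 * (1 + - \<delta>))"
    proof -
      have "- \<delta> \<le> - \<alpha>" using lnx by (simp add: \<delta>_def)
      then show ?thesis
        unfolding power2_minus using False \<alpha>0 by (intro divide_left_mono mult_pos_pos) auto
    qed
    also have "\<dots> \<le> exp (- (-\<delta>)) - 1 + - \<delta>" using False by (intro exp_minus_ge) auto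
    finally show ?thesis by simp
  qed
  then have "\<delta>\<^sup>2 \<le> 2 * (1 - \<alpha>) * (exp \<delta> - 1 - \<delta>)"
    using \<alpha>0 by (simp add: field_simps)
  then have "(1 - (\<alpha> - \<delta>))\<^sup>2 \<le> \<alpha>\<^sup>2 - 1 + 2 * exp \<delta> * (1 - \<alpha>)"
    by (simp add: power2_eq_square algebra_simps)
  then have "x * (1 - (\<alpha> - \<delta>))\<^sup>2 \<le> x * (\<alpha>\<^sup>2 - 1 + 2 * exp \<delta> * (1 - \<alpha>))"
    using x0 by (intro mult_left_mono) auto
  then show ?thesis
    unfolding phi_def by (simp add: \<alpha>_def[symmetric]) (simp add: \<delta>_def ax algebra_simps)
qed

lemma phi_at_tangent_point: "((ln a)\<^sup>2 - 1) * a + 2 * a * (1 - ln a) = phi a"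
  by (simp add: phi_def power2_eq_square algebra_simps)

lemma mean_phi_le:
  assumes "finite S" "S \<noteq> {}" "\<And>i. i \<in> S \<Longrightarrow> 0 \<le> f i \<and> f i \<le> 1"
  shows "mean S (\<lambda>i. phi (f i)) \<le> phi (mean S f)"
proof -
  define a where "a = mean S f"
  have "a \<ge> 0" unfolding a_def using assms by (intro mean_nonneg) auto
  have a1: "a \<le> 1"
    using mean_mono[of S f "\<lambda>_. 1"] assms by (simp add: a_def mean_const)
  show ?thesis
  proof (cases "a = 0")
    case True
    then have "sum f S = 0" using assms by (simp add: a_def mean_def)
    then have "\<forall>i\<in>S. f i = 0" using assms by (simp add: sum_nonneg_eq_0_iff)
    then have "mean S (\<lambda>i. phi (f i)) = mean S (\<lambda>i. 0)" by (intro mean_cong) (simp add: phi_def)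
    then show ?thesis using True assms by (simp add: mean_const a_def[symmetric]) (simp add: phi_def)
  next
    case False
    then have a0: "a > 0" using \<open>a \<ge> 0\<close> by simp
    have "mean S (\<lambda>i. phi (f i)) \<le> mean S (\<lambda>i. ((ln a)\<^sup>2 - 1) * f i + 2 * a * (1 - ln a))"
      using assms a0 a1 by (intro mean_mono phi_le_tangent) auto
    also have "\<dots> = ((ln a)\<^sup>2 - 1) * a + 2 * a * (1 - ln a)"
      using assms(1,2) unfolding mean_add mean_cmult by (simp add: a_def mean_const)
    also have "\<dots> = phi a" by (rule phi_at_tangent_point)
    finally show ?thesis by (simp add: a_def)
  qed
qed

lemma ent_le_quadratic:
  assumes "p \<ge> 0" "\<mu> > 0"
  shows "ent p \<le> p * ln \<mu> + p * (p / \<mu> - 1)"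
proof (cases "p = 0")
  case False
  then have "p > 0" using assms by simp
  then have "ln p - ln \<mu> \<le> p / \<mu> - 1"
    using ln_le_minus_one[of "p / \<mu>"] assms by (simp add: ln_div)
  then have "p * (ln p - ln \<mu>) \<le> p * (p / \<mu> - 1)" using assms by (intro mult_left_mono) auto
  then show ?thesis by (simp add: ent_def algebra_simps)
qed (simp add: ent_def)

text \<open>The left side minus \<open>ent\<close> \<mu> is \<mu> times the relative entropy of a
  bit whose two outcomes have weights \<mu> - b and \<mu> + b. It is bounded by its chi-square
  counterpart, which is quadratic in the bias and hence within reach of the level-two
  inequality.\<close>

lemma ent_split_le:
  assumes "\<mu> > 0" "\<bar>b\<bar> \<le> \<mu>"
  shows "(ent (\<mu> - b) + ent (\<mu> + b)) / 2 \<le> ent \<mu> + b\<^sup>2 / \<mu>"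
proof -
  have "ent (\<mu> - b) + ent (\<mu> + b) \<le> (\<mu> - b) * ln \<mu> + (\<mu> - b) * ((\<mu> - b) / \<mu> - 1)
      + ((\<mu> + b) * ln \<mu> + (\<mu> + b) * ((\<mu> + b) / \<mu> - 1))"
    using assms by (intro add_mono ent_le_quadratic) auto
  also have "\<dots> = 2 * (ent \<mu> + b\<^sup>2 / \<mu>)"
    using assms by (simp add: ent_def field_simps power2_eq_square)
  finally show ?thesis by (simp add: mult.commute)
qed

text \<open>The bracket is the pointwise divergence of p from \<mu>; it dominates the squared
  Hellinger term (sqrt p - sqrt \<mu>)^2 because ln z \<le> z - 1. Factoring p - \<mu> as a
  difference of squares and splitting the product by the arithmetic-geometric mean inequality
  introduces the weight \<tau>. Being pointwise, the bound can be averaged over bit strings and then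
  added up over messages.\<close>

lemma abs_diff_le_ent:
  assumes "p \<ge> 0" "\<mu> > 0" "\<tau> > 0"
  shows "\<bar>p - \<mu>\<bar> \<le> (ent p - p * ln \<mu> - p + \<mu>) / (2 * \<tau>) + \<tau> * (p + \<mu>)"
proof -
  define x where "x = sqrt p"
  define y where "y = sqrt \<mu>"
  have xy: "x \<ge> 0" "y > 0" "p = x\<^sup>2" "\<mu> = y\<^sup>2" using assms by (auto simp: x_def y_def)
  have hell: "(x - y)\<^sup>2 \<le> ent p - p * ln \<mu> - p + \<mu>"
  proof (cases "x = 0")
    case False
    then have x0: "x > 0" using xy by simp
    have "ln (y / x) \<le> y / x - 1" using x0 xy by (intro ln_le_minus_one) auto
    then have "ln x - ln y \<ge> 1 - y / x" using x0 xy by (simp add: ln_div)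
    then have "2 * x\<^sup>2 * (1 - y / x) \<le> 2 * x\<^sup>2 * (ln x - ln y)"
      by (intro mult_left_mono) auto
    then show ?thesis using x0 xy
      by (simp add: ent_def ln_realpow power2_eq_square algebra_simps ln_mult)
  qed (use xy in \<open>simp add: ent_def\<close>)
  have "\<bar>p - \<mu>\<bar> = \<bar>x - y\<bar> * (x + y)"
    using xy by (simp add: power2_eq_square square_diff_square_factored abs_mult)
  also have "\<dots> \<le> (x - y)\<^sup>2 / (2 * \<tau>) + \<tau> * (x + y)\<^sup>2 / 2"
  proof -
    have "0 \<le> (\<bar>x - y\<bar> - \<tau> * (x + y))\<^sup>2" by simp
    also have "\<dots> = (x - y)\<^sup>2 - 2 * \<tau> * (\<bar>x - y\<bar> * (x + y)) + \<tau>\<^sup>2 * (x + y)\<^sup>2"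
      unfolding power2_diff[of "\<bar>x - y\<bar>"] power_mult_distrib by simp
    finally show ?thesis using assms(3) by (simp add: field_simps power2_eq_square)
  qed
  also have "\<dots> \<le> (ent p - p * ln \<mu> - p + \<mu>) / (2 * \<tau>) + \<tau> * (p + \<mu>)"
  proof (intro add_mono divide_right_mono hell)
    have "(x + y)\<^sup>2 \<le> 2 * (x\<^sup>2 + y\<^sup>2)"
      using zero_le_power2[of "x - y"] by (simp add: power2_eq_square algebra_simps)
    then have "\<tau> * (x + y)\<^sup>2 \<le> \<tau> * (2 * (x\<^sup>2 + y\<^sup>2))"
      using assms(3) by (intro mult_left_mono) auto
    then show "\<tau> * (x + y)\<^sup>2 / 2 \<le> \<tau> * (p + \<mu>)" using xy by (simp add: algebra_simps)
  qed (use assms in auto)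
  finally show ?thesis .
qed

section \<open>Boolean Hidden Matching\<close>

text \<open>Partial matchings carry an order on their edges: bits are attached by position, and
  dropping the head is one step of the revelation process.\<close>

definition matchings :: "nat \<Rightarrow> 'a set \<Rightarrow> 'a set \<Rightarrow> ('a \<times> 'a) list set" where
  "matchings k L R =
     {es. length es = k \<and> distinct (map fst es) \<and> distinct (map snd es) \<and> set es \<subseteq> L \<times> R}"

definition parities :: "('a \<times> 'a) list \<Rightarrow> 'a set \<Rightarrow> bool list" where
  "parities es Z = map (\<lambda>(u, v). (u \<in> Z) \<noteq> (v \<in> Z)) es"

lemma length_parities [simp]: "length (parities es Z) = length es"
  by (simp add: parities_def)

lemma parities_Cons: "parities ((u, v) # es) Z = ((u \<in> Z) \<noteq> (v \<in> Z)) # parities es Z"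
  by (simp add: parities_def)

text \<open>For an unnormalised density \<open>g\<close> of \<open>Z\<close>, the likelihood ratio of \<open>ws\<close> against uniformly
  random bits is \<open>mass\<close> divided by the mean of \<open>g\<close>.\<close>

definition mass :: "'a set \<Rightarrow> ('a \<times> 'a) list \<Rightarrow> bool list \<Rightarrow> ('a set \<Rightarrow> real) \<Rightarrow> real" where
  "mass V es ws g = 2 ^ length es * mean (Pow V) (\<lambda>Z. g Z * of_bool (parities es Z = ws))"

text \<open>The density on the remaining coordinates after learning only the parity of \<open>u\<close> and \<open>v\<close>;
  averaging over the two consistent values of the pair keeps the density bounded by \<open>1\<close>.\<close>

definition reveal :: "'a \<Rightarrow> 'a \<Rightarrow> bool \<Rightarrow> ('a set \<Rightarrow> real) \<Rightarrow> 'a set \<Rightarrow> real" where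
  "reveal u v w g Z =
     (if w then g (insert u Z) + g (insert v Z) else g Z + g (insert u (insert v Z))) / 2"

section \<open>Counting ordered matchings and bit strings\<close>

lemma matchings_0 [simp]: "matchings 0 L R = {[]}"
  by (auto simp: matchings_def)

lemma matchings_Suc:
  "matchings (Suc k) L R =
    (\<lambda>(p, es). p # es) ` (SIGMA p:L \<times> R. matchings k (L - {fst p}) (R - {snd p}))"
proof (intro equalityI subsetI)
  fix es assume es: "es \<in> matchings (Suc k) L R"
  then obtain p es' where p: "es = p # es'" by (cases es) (auto simp: matchings_def)
  have "es' \<in> matchings k (L - {fst p}) (R - {snd p})"
    using es unfolding p matchings_def by (cases p) (auto simp: image_iff)
  moreover have "p \<in> L \<times> R" using es by (auto simp: p matchings_def)
  ultimately show "es \<in> (\<lambda>(p, es). p # es) ` (SIGMA p:L \<times> R. matchings k (L - {fst p}) (R - {snd p}))"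
    using p by (auto intro!: image_eqI[of _ _ "(p, es')"])
qed (auto simp: matchings_def; force)

lemma finite_matchings: "finite L \<Longrightarrow> finite R \<Longrightarrow> finite (matchings k L R)"
  by (induction k arbitrary: L R) (auto simp: matchings_Suc)

lemma card_matchings:
  assumes "finite L" "finite R"
  shows "card (matchings k L R) = (\<Prod>j<k. (card L - j) * (card R - j))"
  using assms
proof (induction k arbitrary: L R)
  case (Suc k)
  have inj: "inj_on (\<lambda>(p, es). p # es) (SIGMA p:L \<times> R. matchings k (L - {fst p}) (R - {snd p}))"
    by (auto simp: inj_on_def)
  have "card (matchings (Suc k) L R) = (\<Sum>p\<in>L \<times> R. card (matchings k (L - {fst p}) (R - {snd p})))"
    unfolding matchings_Suc card_image[OF inj] using Suc.prems
    by (intro card_SigmaI) (auto simp: finite_matchings)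
  also have "\<dots> = (\<Sum>p\<in>L \<times> R. \<Prod>j<k. (card L - Suc j) * (card R - Suc j))"
    using Suc.prems by (intro sum.cong refl) (auto simp: Suc.IH)
  finally show ?case
    by (simp add: card_cartesian_product prod.lessThan_Suc_shift del: prod.lessThan_Suc)
qed simp

lemma matchings_nonempty:
  assumes "finite L" "finite R" "k \<le> card L" "k \<le> card R"
  shows "matchings k L R \<noteq> {}"
proof
  assume "matchings k L R = {}"
  then have "(\<Prod>j<k. (card L - j) * (card R - j)) = 0"
    using card_matchings[OF assms(1,2), of k] by simp
  then show False using assms by auto
qed

text \<open>Every first edge has the same number of continuations, as that number depends only on
  the sizes of the two sides. So the head of a uniform ordered matching is uniform on all pairs,
  which is what lets the level-two sum over all pairs appear as an average.\<close>

lemma mean_matchings_Suc: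
  assumes "finite L" "finite R"
  shows "mean (matchings (Suc k) L R) F =
    mean (L \<times> R) (\<lambda>p. mean (matchings k (L - {fst p}) (R - {snd p})) (\<lambda>es. F (p # es)))"
proof -
  have inj: "inj_on (\<lambda>(p, es). p # es) (SIGMA p:L \<times> R. matchings k (L - {fst p}) (R - {snd p}))"
    by (auto simp: inj_on_def)
  define N where "N = (\<Prod>j<k. (card L - Suc j) * (card R - Suc j))"
  have N: "card (matchings k (L - {fst p}) (R - {snd p})) = N" if "p \<in> L \<times> R" for p
    using that assms by (auto simp: card_matchings N_def)
  have "card (matchings (Suc k) L R) = card (L \<times> R) * N"
    using assms by (simp add: card_matchings N_def card_cartesian_product prod.lessThan_Suc_shift
        del: prod.lessThan_Suc)
  moreover have "sum F (matchings (Suc k) L R)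
    = (\<Sum>p\<in>L \<times> R. \<Sum>es\<in>matchings k (L - {fst p}) (R - {snd p}). F (p # es))"
    unfolding matchings_Suc sum.reindex[OF inj] using assms
    by (subst sum.Sigma) (auto simp: finite_matchings case_prod_unfold)
  ultimately show ?thesis
    by (simp add: mean_def N sum_divide_distrib mult.commute)
qed

lemma mean_lists_Suc:
  "mean {ws :: bool list. length ws = Suc k} F
    = (mean {ws. length ws = k} (\<lambda>ws. F (True # ws)) + mean {ws. length ws = k} (\<lambda>ws. F (False # ws))) / 2"
proof -
  have "bij_betw (\<lambda>(w, ws). w # ws) (UNIV \<times> {ws :: bool list. length ws = k}) {ws. length ws = Suc k}"
    by (rule bij_betwI[of _ _ _ "\<lambda>xs. (hd xs, tl xs)"]) (auto simp: length_Suc_conv)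
  then show ?thesis
    by (simp add: mean_bij_betw mean_Times mean_bool)
qed

lemma finite_bool_lists: "finite {ws :: bool list. length ws = k}"
  using finite_lists_length_eq[of "UNIV :: bool set" k] by simp

lemma bool_lists_nonempty: "{ws :: bool list. length ws = k} \<noteq> {}"
  using length_replicate[of k True] by blast

lemma card_bool_lists: "card {ws :: bool list. length ws = k} = 2 ^ k"
  using card_lists_length_eq[of "UNIV :: bool set" k] by simp

section \<open>Revealing one parity, and the chain rule\<close>

lemma reveal_bounds:
  assumes "\<And>Z. 0 \<le> g Z" "\<And>Z. g Z \<le> 1"
  shows "0 \<le> reveal u v w g Z" "reveal u v w g Z \<le> 1"
  using assms(1)[of Z] assms(2)[of Z] assms(1)[of "insert u Z"] assms(2)[of "insert u Z"]
    assms(1)[of "insert v Z"] assms(2)[of "insert v Z"]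
    assms(1)[of "insert u (insert v Z)"] assms(2)[of "insert u (insert v Z)"]
  by (auto simp: reveal_def)

lemma mean_Pow_insert2:
  assumes "finite V" "u \<noteq> v" "u \<notin> V" "v \<notin> V"
  shows "mean (Pow (insert u (insert v V))) f =
    mean (Pow V) (\<lambda>Z. (f Z + f (insert u Z) + f (insert v Z) + f (insert u (insert v Z))) / 4)"
  using assms by (simp add: mean_Pow_insert add_divide_distrib algebra_simps)

text \<open>Each of the four values of the pair has weight 1/4 and two are consistent with the bit,
  whereas \<open>reveal\<close> divides their sum by 2. The remaining 1/2 cancels one factor of
  2^length.\<close>

lemma mass_Cons:
  assumes V: "finite V" "u \<noteq> v" "u \<notin> V" "v \<notin> V" and es: "set es \<subseteq> V \<times> V"
  shows "mass (insert u (insert v V)) ((u, v) # es) (w # ws) g = mass V es ws (reveal u v w g)"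
proof -
  have par: "parities es (insert u Z) = parities es Z" "parities es (insert v Z) = parities es Z" for Z
    using V es by (auto simp: parities_def)
  have "mean (Pow (insert u (insert v V))) (\<lambda>Z. g Z * of_bool (parities ((u, v) # es) Z = w # ws))
      = mean (Pow V) (\<lambda>Z. (1/2) * (reveal u v w g Z * of_bool (parities es Z = ws)))"
    unfolding mean_Pow_insert2[OF V] using V
    by (intro mean_cong) (auto simp: parities_Cons par reveal_def)
  then show ?thesis unfolding mass_def mean_cmult by simp
qed

text \<open>The product of the two signs is 1 exactly when the parity is \<open>False\<close>.
  Writing \<mu> for the mean and b for the correlation, the outcomes \<open>True\<close> and
  \<open>False\<close> thus have masses \<mu> - b and \<mu> + b, the form required by
  \<open>ent_split_le\<close>.\<close>

lemma mean_reveal: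
  assumes V: "finite V" "u \<noteq> v" "u \<notin> V" "v \<notin> V"
  shows "mean (Pow (insert u (insert v V))) g =
      (mean (Pow V) (reveal u v True g) + mean (Pow V) (reveal u v False g)) / 2"
    and "mean (Pow (insert u (insert v V))) (\<lambda>Z. g Z * (sign u Z * sign v Z)) =
      (mean (Pow V) (reveal u v False g) - mean (Pow V) (reveal u v True g)) / 2"
proof -
  have "mean (Pow (insert u (insert v V))) g
      = mean (Pow V) (\<lambda>Z. (1/2) * (reveal u v True g Z + reveal u v False g Z))"
    unfolding mean_Pow_insert2[OF V] by (intro mean_cong) (simp add: reveal_def add_divide_distrib)
  then show "mean (Pow (insert u (insert v V))) g =
      (mean (Pow V) (reveal u v True g) + mean (Pow V) (reveal u v False g)) / 2"
    unfolding mean_cmult mean_add by simp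
  have "mean (Pow (insert u (insert v V))) (\<lambda>Z. g Z * (sign u Z * sign v Z))
      = mean (Pow V) (\<lambda>Z. (1/2) * (reveal u v False g Z - reveal u v True g Z))"
    unfolding mean_Pow_insert2[OF V] using V by (intro mean_cong) (auto simp: reveal_def sign_def algebra_simps add_divide_distrib diff_divide_distrib)
  then show "mean (Pow (insert u (insert v V))) (\<lambda>Z. g Z * (sign u Z * sign v Z)) =
      (mean (Pow V) (reveal u v False g) - mean (Pow V) (reveal u v True g)) / 2"
    unfolding mean_cmult mean_diff by simp
qed

text \<open>Each revealed parity costs the level-two weight of the current density, averaged over the
  \<open>|L| |R|\<close> possible next edges; by concavity of \<open>phi\<close> this cost does not grow along the
  revelation process.\<close>

lemma mean_ent_mass_le:
  fixes L R :: "'a set"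
  assumes "finite L" "finite R" "L \<inter> R = {}" "card L = card R" "k \<le> card L"
    and "q > 0" "q \<le> real ((card L - k)\<^sup>2)"
    and "\<And>Z. 0 \<le> g Z" "\<And>Z. g Z \<le> 1"
  shows "mean (matchings k L R) (\<lambda>es. mean {ws. length ws = k} (\<lambda>ws. ent (mass (L \<union> R) es ws g)))
    \<le> ent (mean (Pow (L \<union> R)) g) + real k * (4 / q) * phi (mean (Pow (L \<union> R)) g)"
  using assms
proof (induction k arbitrary: L R g)
  case 0
  then show ?case by (simp add: mean_def mass_def parities_def)
next
  case (Suc k)
  note fin = Suc.prems(1-3) and q = Suc.prems(6,7) and g = Suc.prems(8,9)
  define \<mu> where "\<mu> = mean (Pow (L \<union> R)) g"
  define m where "m p w = mean (Pow ((L - {fst p}) \<union> (R - {snd p}))) (reveal (fst p) (snd p) w g)" for p w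
  define b where "b u v = mean (Pow (L \<union> R)) (\<lambda>Z. g Z * (sign u Z * sign v Z))" for u v
  have \<mu>0: "\<mu> \<ge> 0" using g by (auto simp: \<mu>_def intro: mean_nonneg)
  have m_bounds: "0 \<le> m p w" "m p w \<le> 1" for p w
  proof -
    show "0 \<le> m p w" unfolding m_def by (intro mean_nonneg reveal_bounds g)
    have "m p w \<le> mean (Pow ((L - {fst p}) \<union> (R - {snd p}))) (\<lambda>_. 1)"
      unfolding m_def by (intro mean_mono reveal_bounds g)
    then show "m p w \<le> 1" using fin by (subst (asm) mean_const) auto
  qed
  have V: "L \<union> R = insert (fst p) (insert (snd p) ((L - {fst p}) \<union> (R - {snd p})))"
    "finite ((L - {fst p}) \<union> (R - {snd p}))" "fst p \<noteq> snd p"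
    "fst p \<notin> (L - {fst p}) \<union> (R - {snd p})" "snd p \<notin> (L - {fst p}) \<union> (R - {snd p})"
    if "p \<in> L \<times> R" for p
    using that fin by auto
  have m_sum: "\<mu> = (m p True + m p False) / 2" and m_diff: "b (fst p) (snd p) = (m p False - m p True) / 2"
    if p: "p \<in> L \<times> R" for p
    using mean_reveal[OF V(2-5)[OF p], of g] unfolding V(1)[OF p, symmetric] \<mu>_def m_def b_def by auto
  define K where "K = real k * (4 / q)"
  have K0: "K \<ge> 0" using q by (simp add: K_def)
  have mass: "mass (L \<union> R) (p # es) (w # ws) g
      = mass ((L - {fst p}) \<union> (R - {snd p})) es ws (reveal (fst p) (snd p) w g)"
    if p: "p \<in> L \<times> R" and es: "es \<in> matchings k (L - {fst p}) (R - {snd p})" for p es w ws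
    using mass_Cons[OF V(2-5)[OF p], of es w ws g] es
    unfolding V(1)[OF p, symmetric] by (auto simp: matchings_def)
  have step: "mean (matchings k (L - {fst p}) (R - {snd p}))
        (\<lambda>es. mean {ws. length ws = Suc k} (\<lambda>ws. ent (mass (L \<union> R) (p # es) ws g)))
      \<le> ent \<mu> + (b (fst p) (snd p))\<^sup>2 / \<mu> + K * phi \<mu>" (is "?lhs \<le> _")
    if p: "p \<in> L \<times> R" for p
  proof -
    let ?L = "L - {fst p}" and ?R = "R - {snd p}"
    define F where "F w = mean (matchings k ?L ?R) (\<lambda>es. mean {ws. length ws = k}
        (\<lambda>ws. ent (mass (?L \<union> ?R) es ws (reveal (fst p) (snd p) w g))))" for w
    have "?lhs = mean (matchings k ?L ?R) (\<lambda>es. (1/2) *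
       (mean {ws. length ws = k} (\<lambda>ws. ent (mass (?L \<union> ?R) es ws (reveal (fst p) (snd p) True g)))
       + mean {ws. length ws = k} (\<lambda>ws. ent (mass (?L \<union> ?R) es ws (reveal (fst p) (snd p) False g)))))"
      unfolding mean_lists_Suc by (intro mean_cong) (simp add: mass[OF p])
    also have "\<dots> = (F True + F False) / 2"
      unfolding mean_cmult mean_add F_def by simp
    also have "\<dots> \<le> ((ent (m p True) + K * phi (m p True)) + (ent (m p False) + K * phi (m p False))) / 2"
    proof -
      \<comment> \<open>Removing an edge shortens the matching and each side by one, so card L - k
        is unchanged and the same \<open>q\<close> serves at every depth. It bounds the number of
        pairs still available from below.\<close>
      have "F w \<le> ent (m p w) + K * phi (m p w)" for w
        unfolding F_def m_def K_def using Suc.prems p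
        by (intro Suc.IH reveal_bounds) auto
      from this[of True] this[of False] show ?thesis by simp
    qed
    also have "\<dots> = (ent (m p True) + ent (m p False)) / 2 + K * ((phi (m p True) + phi (m p False)) / 2)"
      by (simp add: algebra_simps add_divide_distrib)
    also have "\<dots> \<le> ent \<mu> + (b (fst p) (snd p))\<^sup>2 / \<mu> + K * phi \<mu>"
    proof (intro add_mono mult_left_mono K0)
      show "(phi (m p True) + phi (m p False)) / 2 \<le> phi \<mu>"
        using mean_phi_le[of UNIV "m p"] m_bounds unfolding mean_bool m_sum[OF p] by simp
      show "(ent (m p True) + ent (m p False)) / 2 \<le> ent \<mu> + (b (fst p) (snd p))\<^sup>2 / \<mu>"
      proof (cases "\<mu> = 0")
        case True
        then have "m p True = 0" "m p False = 0"
          using m_sum[OF p] m_bounds(1)[of p True] m_bounds(1)[of p False] by auto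
        then show ?thesis using True by (simp add: ent_def)
      next
        case False
        have e: "m p True = \<mu> - b (fst p) (snd p)" "m p False = \<mu> + b (fst p) (snd p)"
          unfolding m_diff[OF p] m_sum[OF p] by (auto simp: field_simps)
        show ?thesis
          unfolding e using False \<mu>0 m_bounds(1)[of p True] m_bounds(1)[of p False]
          unfolding e by (intro ent_split_le) auto
      qed
    qed
    finally show ?thesis .
  qed
  have LR: "finite (L \<times> R)" "L \<times> R \<noteq> {}"
    using Suc.prems(1,2,4,5) by auto
  have level2: "mean (L \<times> R) (\<lambda>p. (b (fst p) (snd p))\<^sup>2 / \<mu>) \<le> (4 / q) * phi \<mu>"
  proof (cases "\<mu> = 0")
    \<comment> \<open>Division by zero gives 0, so both sides vanish.\<close>
    case True
    then show ?thesis using LR by (simp add: phi_def mean_const)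
  next
    case False
    then have \<mu>0': "\<mu> > 0" using \<mu>0 by simp
    have card: "q \<le> real (card (L \<times> R))"
    proof -
      have "(card L - Suc k)\<^sup>2 \<le> (card L)\<^sup>2" by (intro power_mono) auto
      then have "real ((card L - Suc k)\<^sup>2) \<le> real ((card L)\<^sup>2)" by (rule of_nat_mono)
      also have "(card L)\<^sup>2 = card (L \<times> R)"
        using Suc.prems(4) by (simp add: card_cartesian_product power2_eq_square)
      finally show ?thesis using q by linarith
    qed
    have "(\<Sum>p\<in>L \<times> R. (b (fst p) (snd p))\<^sup>2) = (\<Sum>u\<in>L. \<Sum>v\<in>R. (b u v)\<^sup>2)"
      by (simp add: sum.cartesian_product case_prod_unfold)
    also have "\<dots> \<le> 4 * (\<mu> * (1 - ln \<mu>))\<^sup>2"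
      unfolding b_def using level_two_inequality[OF fin g \<mu>_def \<mu>0'] .
    finally have "(\<Sum>p\<in>L \<times> R. (b (fst p) (snd p))\<^sup>2) / \<mu> \<le> 4 * phi \<mu>"
      using \<mu>0' by (simp add: phi_def field_simps power2_eq_square)
    then have "mean (L \<times> R) (\<lambda>p. (b (fst p) (snd p))\<^sup>2 / \<mu>) \<le> 4 * phi \<mu> / real (card (L \<times> R))"
      unfolding mean_def sum_divide_distrib[symmetric] by (intro divide_right_mono) auto
    also have "\<dots> \<le> 4 * phi \<mu> / q"
      using card q(1) \<mu>0 by (intro divide_left_mono) (auto simp: phi_def)
    finally show ?thesis by simp
  qed
  have "mean (matchings (Suc k) L R) (\<lambda>es. mean {ws. length ws = Suc k} (\<lambda>ws. ent (mass (L \<union> R) es ws g)))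
      \<le> mean (L \<times> R) (\<lambda>p. (ent \<mu> + K * phi \<mu>) + (b (fst p) (snd p))\<^sup>2 / \<mu>)"
    unfolding mean_matchings_Suc[OF fin(1,2)] using step
    by (intro mean_mono) (simp add: algebra_simps)
  also have "\<dots> = ent \<mu> + K * phi \<mu> + mean (L \<times> R) (\<lambda>p. (b (fst p) (snd p))\<^sup>2 / \<mu>)"
    unfolding mean_add using LR by (simp add: mean_const)
  also have "\<dots> \<le> ent \<mu> + K * phi \<mu> + (4 / q) * phi \<mu>" using level2 by simp
  also have "\<dots> = ent \<mu> + real (Suc k) * (4 / q) * phi \<mu>"
    by (simp add: K_def algebra_simps add_divide_distrib)
  finally show ?case unfolding \<mu>_def .
qed

section \<open>From relative entropy to distinguishing advantage\<close>

lemma mean_mass: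
  "length es = k \<Longrightarrow> mean {ws. length ws = k} (\<lambda>ws. mass V es ws g * F ws)
     = mean (Pow V) (\<lambda>Z. g Z * F (parities es Z))"
proof -
  assume k: "length es = k"
  have "mean {ws. length ws = k} (\<lambda>ws. mass V es ws g * F ws)
    = (\<Sum>ws | length ws = k. mean (Pow V) (\<lambda>Z. F ws * (g Z * of_bool (parities es Z = ws))))"
    unfolding mean_cmult by (simp add: mean_def[of "{ws. length ws = k}"] mass_def card_bool_lists k sum_divide_distrib mult_ac)
  also have "\<dots> = mean (Pow V) (\<lambda>Z. \<Sum>ws | length ws = k. F ws * (g Z * of_bool (parities es Z = ws)))"
    by (rule mean_sum[symmetric])
  also have "\<dots> = mean (Pow V) (\<lambda>Z. g Z * F (parities es Z))"
  proof (rule mean_cong)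
    fix Z
    have "(\<Sum>ws | length ws = k. F ws * (g Z * of_bool (parities es Z = ws)))
      = (\<Sum>ws | length ws = k. if parities es Z = ws then F ws * g Z else 0)"
      by (intro sum.cong) auto
    also have "\<dots> = F (parities es Z) * g Z"
      by (subst sum.delta') (auto simp: finite_bool_lists k)
    finally show "(\<Sum>ws | length ws = k. F ws * (g Z * of_bool (parities es Z = ws))) = g Z * F (parities es Z)"
      by simp
  qed
  finally show ?thesis .
qed

lemma mean_map_Not: "mean {ws. length ws = k} (\<lambda>ws. F (map Not ws)) = mean {ws. length ws = k} F"
proof -
  have "bij_betw (map Not) {ws. length ws = k} {ws. length ws = k}"
    by (rule bij_betwI[of _ _ _ "map Not"]) (auto simp: comp_def)
  from mean_bij_betw[OF this] show ?thesis by simp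
qed

text \<open>Under uniform bits \<open>mass\<close> has average \<mu>, so averaging the pointwise
  bound cancels its linear terms and leaves the entropy increase over \<open>ent\<close> \<mu>. The
  increase is the relative entropy of the parities against uniform bits, scaled by \<mu>.\<close>

lemma mean_abs_mass_le:
  assumes V: "finite V" and es: "length es = k" and g: "\<And>Z. 0 \<le> g Z" and \<tau>: "\<tau> > 0"
    and \<mu>: "\<mu> = mean (Pow V) g"
  shows "mean {ws. length ws = k} (\<lambda>ws. \<bar>mass V es ws g - \<mu>\<bar>)
    \<le> (mean {ws. length ws = k} (\<lambda>ws. ent (mass V es ws g)) - ent \<mu>) / (2 * \<tau>) + 2 * \<tau> * \<mu>"
proof -
  let ?W = "{ws :: bool list. length ws = k}"
  have W: "finite ?W" "?W \<noteq> {}" by (fact finite_bool_lists bool_lists_nonempty)+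
  have mass0: "0 \<le> mass V es ws g" for ws
    unfolding mass_def using g by (intro mult_nonneg_nonneg mean_nonneg) auto
  have avg: "mean ?W (\<lambda>ws. mass V es ws g) = \<mu>"
    using mean_mass[OF es, of V g "\<lambda>_. 1"] by (simp add: \<mu>)
  show ?thesis
  proof (cases "\<mu> = 0")
    case True
    then have "(\<Sum>ws\<in>?W. mass V es ws g) = 0"
      using avg W by (auto simp: mean_def)
    then have "\<forall>ws\<in>?W. mass V es ws g = 0"
      using W mass0 by (simp add: sum_nonneg_eq_0_iff)
    then have "mean ?W (\<lambda>ws. \<bar>mass V es ws g - \<mu>\<bar>) = mean ?W (\<lambda>_. 0)"
      "mean ?W (\<lambda>ws. ent (mass V es ws g)) = mean ?W (\<lambda>_. 0)"
      using True by (auto intro!: mean_cong simp: ent_def)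
    then show ?thesis using True W by (simp add: mean_const ent_def)
  next
    case False
    then have \<mu>0: "\<mu> > 0" using mean_nonneg[of "Pow V" g] g \<mu> by force
    have "mean ?W (\<lambda>ws. \<bar>mass V es ws g - \<mu>\<bar>) \<le>
      mean ?W (\<lambda>ws. (1 / (2 * \<tau>)) * (ent (mass V es ws g) + (- ln \<mu> - 1) * mass V es ws g + \<mu>)
        + \<tau> * (mass V es ws g + \<mu>))"
    proof (rule mean_mono)
      fix ws
      show "\<bar>mass V es ws g - \<mu>\<bar> \<le> (1 / (2 * \<tau>)) * (ent (mass V es ws g) + (- ln \<mu> - 1) * mass V es ws g + \<mu>)
        + \<tau> * (mass V es ws g + \<mu>)"
        using abs_diff_le_ent[OF mass0 \<mu>0 \<tau>, of ws]
        by (simp add: algebra_simps add_divide_distrib diff_divide_distrib)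
    qed
    also have "\<dots> = (1 / (2 * \<tau>)) * (mean ?W (\<lambda>ws. ent (mass V es ws g)) + (- ln \<mu> - 1) * \<mu> + \<mu>)
        + \<tau> * (\<mu> + \<mu>)"
      unfolding mean_add mean_cmult avg mean_const[OF W] ..
    also have "\<dots> = (mean ?W (\<lambda>ws. ent (mass V es ws g)) - ent \<mu>) / (2 * \<tau>) + 2 * \<tau> * \<mu>"
      by (simp add: ent_def algebra_simps add_divide_distrib diff_divide_distrib)
    finally show ?thesis .
  qed
qed

text \<open>Flipping all bits preserves the uniform distribution, so the difference of the two
  decoder values averages to zero over uniform bits. Only the deviation of \<open>mass\<close> from
  its mean can therefore help, and the difference is at most 1 in absolute value, so the advantage
  is at most the mean absolute deviation, summed over messages.\<close>

lemma hidden_matching_advantage_le: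
  fixes L R :: "'a set" and msg :: "'a set \<Rightarrow> 'm"
    and dec :: "'m \<Rightarrow> ('a \<times> 'a) list \<Rightarrow> bool list \<Rightarrow> real"
  assumes LR: "finite L" "finite R" "L \<inter> R = {}" "card L = card R" "k \<le> card L"
    and q: "q > 0" "q \<le> real ((card L - k)\<^sup>2)" and \<tau>: "\<tau> > 0"
    and Ms: "finite Ms" "\<And>Z. Z \<subseteq> L \<union> R \<Longrightarrow> msg Z \<in> Ms"
    and dec: "\<And>m es ws. 0 \<le> dec m es ws" "\<And>m es ws. dec m es ws \<le> 1"
  shows "mean (matchings k L R) (\<lambda>es. mean (Pow (L \<union> R)) (\<lambda>Z.
      dec (msg Z) es (parities es Z) - dec (msg Z) es (map Not (parities es Z))))
    \<le> real k * (4 / q) * (1 + ln (real (card Ms)))\<^sup>2 / (2 * \<tau>) + 2 * \<tau>"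
proof -
  define V where "V = L \<union> R"
  let ?W = "{ws :: bool list. length ws = k}"
  have W: "finite ?W" "?W \<noteq> {}" by (fact finite_bool_lists bool_lists_nonempty)+
  have V: "finite V" using LR by (simp add: V_def)
  have PV: "finite (Pow V)" "Pow V \<noteq> {}" using V by auto
  define g where "g m Z = (of_bool (msg Z = m) :: real)" for m Z
  have g: "\<And>m Z. 0 \<le> g m Z" "\<And>m Z. g m Z \<le> 1" by (auto simp: g_def)
  define \<mu> where "\<mu> m = mean (Pow V) (g m)" for m
  define H where "H m es = mean ?W (\<lambda>ws. ent (mass V es ws (g m)))" for m es
  have \<mu>_bounds: "0 \<le> \<mu> m \<and> \<mu> m \<le> 1" for m
    using mean_nonneg[of "Pow V" "g m"] mean_mono[of "Pow V" "g m" "\<lambda>_. 1"] g PV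
    by (simp add: \<mu>_def mean_const)
  have g_sum: "(\<Sum>m\<in>Ms. g m Z * f m) = f (msg Z)" if "Z \<in> Pow V" for Z and f :: "'m \<Rightarrow> real"
  proof -
    have "(\<Sum>m\<in>Ms. g m Z * f m) = (\<Sum>m\<in>Ms. if msg Z = m then f m else 0)"
      by (intro sum.cong) (auto simp: g_def)
    then show ?thesis using Ms that by (simp add: V_def)
  qed
  have \<mu>_sum: "(\<Sum>m\<in>Ms. \<mu> m) = 1"
  proof -
    have "(\<Sum>m\<in>Ms. \<mu> m) = mean (Pow V) (\<lambda>Z. \<Sum>m\<in>Ms. g m Z * 1)"
      by (simp add: \<mu>_def mean_sum)
    also have "\<dots> = mean (Pow V) (\<lambda>_. 1)" by (intro mean_cong g_sum)
    finally show ?thesis using PV by (simp add: mean_const)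
  qed
  have Ms0: "Ms \<noteq> {}" using \<mu>_sum by auto
  \<comment> \<open>By concavity the sum is largest when all messages are equally likely, and then
    it equals the right-hand side.\<close>
  have phi_sum: "(\<Sum>m\<in>Ms. phi (\<mu> m)) \<le> (1 + ln (real (card Ms)))\<^sup>2"
  proof -
    have c: "real (card Ms) > 0" using Ms Ms0 by (simp add: card_gt_0_iff)
    have "mean Ms (\<lambda>m. phi (\<mu> m)) \<le> phi (mean Ms \<mu>)"
      using Ms Ms0 \<mu>_bounds by (intro mean_phi_le) auto
    then have "(\<Sum>m\<in>Ms. phi (\<mu> m)) / real (card Ms) \<le> phi (1 / real (card Ms))"
      by (simp add: mean_def \<mu>_sum)
    then show ?thesis using c by (simp add: phi_def ln_div field_simps)
  qed
  have fixed: "mean (Pow V) (\<lambda>Z. dec (msg Z) es (parities es Z) - dec (msg Z) es (map Not (parities es Z)))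
      \<le> (\<Sum>m\<in>Ms. (H m es - ent (\<mu> m)) / (2 * \<tau>) + 2 * \<tau> * \<mu> m)" (is "?adv \<le> _")
    if "length es = k" for es
  proof -
    define D where "D m ws = dec m es ws - dec m es (map Not ws)" for m ws
    have D0: "mean ?W (D m) = 0" for m
      unfolding D_def mean_diff mean_map_Not[of k "dec m es"] by simp
    have "?adv = mean (Pow V) (\<lambda>Z. \<Sum>m\<in>Ms. g m Z * D m (parities es Z))"
      by (intro mean_cong) (simp add: g_sum D_def)
    also have "\<dots> = (\<Sum>m\<in>Ms. mean ?W (\<lambda>ws. mass V es ws (g m) * D m ws))"
      unfolding mean_sum mean_mass[OF that] ..
    also have "\<dots> = (\<Sum>m\<in>Ms. mean ?W (\<lambda>ws. (mass V es ws (g m) - \<mu> m) * D m ws))"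
      by (intro sum.cong refl) (simp add: left_diff_distrib mean_diff mean_cmult D0)
    also have "\<dots> \<le> (\<Sum>m\<in>Ms. mean ?W (\<lambda>ws. \<bar>mass V es ws (g m) - \<mu> m\<bar>))"
    proof (intro sum_mono mean_mono)
      fix m ws
      have "\<bar>D m ws\<bar> \<le> 1" using dec[of m es ws] dec[of m es "map Not ws"] by (auto simp: D_def)
      then have "\<bar>mass V es ws (g m) - \<mu> m\<bar> * \<bar>D m ws\<bar> \<le> \<bar>mass V es ws (g m) - \<mu> m\<bar>"
        by (simp add: mult_left_le)
      then show "(mass V es ws (g m) - \<mu> m) * D m ws \<le> \<bar>mass V es ws (g m) - \<mu> m\<bar>"
        by (metis abs_ge_self abs_mult order_trans)
    qed
    also have "\<dots> \<le> (\<Sum>m\<in>Ms. (H m es - ent (\<mu> m)) / (2 * \<tau>) + 2 * \<tau> * \<mu> m)"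
      unfolding H_def by (intro sum_mono mean_abs_mass_le V that g \<tau>) (simp add: \<mu>_def)
    finally show ?thesis .
  qed
  have M: "finite (matchings k L R)" "matchings k L R \<noteq> {}"
    using LR finite_matchings[of L R k] matchings_nonempty[of L R k] by simp_all
  have "mean (matchings k L R) (\<lambda>es. mean (Pow V) (\<lambda>Z.
      dec (msg Z) es (parities es Z) - dec (msg Z) es (map Not (parities es Z))))
    \<le> mean (matchings k L R) (\<lambda>es. \<Sum>m\<in>Ms. (1 / (2 * \<tau>)) * (H m es - ent (\<mu> m)) + 2 * \<tau> * \<mu> m)"
    using fixed by (intro mean_mono) (auto simp: matchings_def)
  also have "\<dots> = (\<Sum>m\<in>Ms. (1 / (2 * \<tau>)) * (mean (matchings k L R) (H m) - ent (\<mu> m)) + 2 * \<tau> * \<mu> m)"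
    unfolding mean_sum mean_add mean_cmult mean_diff mean_const[OF M] ..
  also have "\<dots> \<le> (\<Sum>m\<in>Ms. (1 / (2 * \<tau>)) * (real k * (4 / q) * phi (\<mu> m)) + 2 * \<tau> * \<mu> m)"
  proof (intro sum_mono add_mono mult_left_mono order_refl)
    fix m
    show "mean (matchings k L R) (H m) - ent (\<mu> m) \<le> real k * (4 / q) * phi (\<mu> m)"
      using mean_ent_mass_le[OF LR q, of "g m"] g unfolding H_def V_def \<mu>_def by simp
  qed (use \<tau> in auto)
  also have "\<dots> = (1 / (2 * \<tau>)) * (real k * (4 / q) * (\<Sum>m\<in>Ms. phi (\<mu> m))) + 2 * \<tau>"
    unfolding sum.distrib sum_distrib_left[symmetric] \<mu>_sum by simp
  also have "\<dots> \<le> (1 / (2 * \<tau>)) * (real k * (4 / q) * (1 + ln (real (card Ms)))\<^sup>2) + 2 * \<tau>"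
    using q \<tau> by (intro add_mono mult_left_mono phi_sum) auto
  finally show ?thesis by (simp add: V_def)
qed

section \<open>Stars and matchings inside the hubs graph\<close>

definition relabel :: "('a \<Rightarrow> 'b) \<Rightarrow> 'a graph \<Rightarrow> 'b graph" where
  "relabel f G = (f ` verts G, (`) f ` edges G)"

lemma triangles_relabel:
  assumes inj: "inj_on f (verts G)" and sub: "\<And>e. e \<in> edges G \<Longrightarrow> e \<subseteq> verts G"
  shows "triangles (relabel f G) = triangles G"
proof -
  let ?T = "{t. t \<subseteq> verts G \<and> card t = 3 \<and> (\<forall>u\<in>t. \<forall>v\<in>t. u \<noteq> v \<longrightarrow> {u, v} \<in> edges G)}"
  let ?T' = "{t. t \<subseteq> f ` verts G \<and> card t = 3 \<and>
    (\<forall>u\<in>t. \<forall>v\<in>t. u \<noteq> v \<longrightarrow> {u, v} \<in> (`) f ` edges G)}"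
  have "?T' = (`) f ` ?T"
  proof (intro equalityI subsetI)
    fix t' assume t': "t' \<in> ?T'"
    then obtain t where t: "t \<subseteq> verts G" "t' = f ` t" by (auto simp: subset_image_iff)
    have injt: "inj_on f t" using inj t(1) by (rule inj_on_subset)
    have "{u, v} \<in> edges G" if uv: "u \<in> t" "v \<in> t" "u \<noteq> v" for u v
    proof -
      have "f u \<noteq> f v" using uv injt by (auto dest: inj_onD)
      then have "{f u, f v} \<in> (`) f ` edges G" using t' t uv by auto
      then obtain e where e: "e \<in> edges G" "f ` e = f ` {u, v}" by auto
      have "e = {u, v}"
        using inj_on_image_eq_iff[OF inj sub[OF e(1)], of "{u, v}"] e t uv by auto
      then show ?thesis using e by simp
    qed
    moreover have "card t = 3" using t' t card_image[OF injt] by simp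
    ultimately show "t' \<in> (`) f ` ?T" using t by blast
  next
    fix t' assume "t' \<in> (`) f ` ?T"
    then obtain t where t: "t \<in> ?T" "t' = f ` t" by blast
    have "inj_on f t" using inj t(1) by (auto intro: inj_on_subset)
    then have "card t' = 3" using t by (simp add: card_image)
    moreover have "{f u, f v} \<in> (`) f ` edges G" if "u \<in> t" "v \<in> t" "f u \<noteq> f v" for u v
    proof -
      have "{u, v} \<in> edges G" using t that by auto
      from imageI[OF this, of "(`) f"] show ?thesis by simp
    qed
    ultimately show "t' \<in> ?T'" using t by auto
  qed
  moreover have "inj_on ((`) f) ?T"
    using inj by (intro inj_on_subset[OF inj_on_image_Pow]) auto
  ultimately show ?thesis
    by (simp add: triangles_def relabel_def card_image)
qed

text \<open>The edge set need not lie in \<open>G\<close>, only its image under the involution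
  \<sigma>. That image is the subgraph, and undoing \<sigma> before labelling is the
  isomorphism.\<close>

lemma admissible_input_relabel:
  assumes G: "simple_graph G" and lab: "bij_betw lab (verts G) {..<card (verts G)}"
    and \<sigma>: "\<And>x. \<sigma> (\<sigma> x) = x" "\<sigma> ` verts G \<subseteq> verts G" "\<And>e. e \<in> E \<Longrightarrow> \<sigma> ` e \<in> edges G"
  shows "admissible_input G (relabel lab (verts G, E))"
proof -
  define H where "H = (verts G, (`) \<sigma> ` E)"
  have "subgraph H G"
    using G \<sigma>(3) by (auto simp: subgraph_def simple_graph_def H_def)
  moreover have "graph_iso H (relabel lab (verts G, E))"
  proof -
    have "\<sigma> ` verts G = verts G"
    proof (intro equalityI subsetI)
      fix x assume "x \<in> verts G"
      then have "\<sigma> x \<in> verts G" using \<sigma>(2) by auto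
      then show "x \<in> \<sigma> ` verts G" using \<sigma>(1)[of x] by (metis imageI)
    qed (use \<sigma>(2) in auto)
    moreover have "inj_on \<sigma> (verts G)" using \<sigma>(1) by (metis inj_onI)
    ultimately have "bij_betw \<sigma> (verts G) (verts G)" by (simp add: bij_betw_def)
    then have "bij_betw (lab \<circ> \<sigma>) (verts G) {..<card (verts G)}" using lab by (rule bij_betw_trans)
    moreover have "lab ` verts G = {..<card (verts G)}" using lab by (simp add: bij_betw_def)
    moreover have "(\<lambda>e. (lab \<circ> \<sigma>) ` e) ` ((`) \<sigma> ` E) = (`) lab ` E"
      unfolding image_image by (simp add: image_image \<sigma>(1))
    ultimately show ?thesis
      unfolding graph_iso_def H_def relabel_def by (intro exI[of _ "lab \<circ> \<sigma>"]) simp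
  qed
  moreover have "verts (relabel lab (verts G, E)) \<subseteq> {..<card (verts G)}"
    using lab by (simp add: relabel_def bij_betw_def)
  ultimately show ?thesis unfolding admissible_input_def by blast
qed

lemma involution_of_matching:
  assumes sym: "\<And>x y. P x y \<Longrightarrow> P y x" and unique: "\<And>x y z. P x y \<Longrightarrow> P x z \<Longrightarrow> y = z"
  shows "\<exists>\<sigma>. (\<forall>x. \<sigma> (\<sigma> x) = x) \<and> (\<forall>x y. P x y \<longrightarrow> \<sigma> x = y) \<and> (\<forall>x. \<sigma> x \<noteq> x \<longrightarrow> P x (\<sigma> x))"
proof -
  define \<sigma> where "\<sigma> x = (if \<exists>y. P x y then THE y. P x y else x)" for x
  have 1: "\<sigma> x = y" if "P x y" for x y
    using that unique unfolding \<sigma>_def by (auto intro!: the_equality)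
  have 2: "\<sigma> x = x" if "\<nexists>y. P x y" for x
    using that by (simp add: \<sigma>_def)
  have "\<sigma> (\<sigma> x) = x" for x using 1 2 sym by (cases "\<exists>y. P x y") metis+
  moreover have "P x (\<sigma> x)" if "\<sigma> x \<noteq> x" for x using 1 2 that by metis
  ultimately show ?thesis using 1 by blast
qed

section \<open>Adjacency and triangles of the hubs graph\<close>

lemma verts_hubs_graph:
  "Hub i \<in> verts (hubs_graph r d) \<longleftrightarrow> i < r"
  "Rim i j b \<in> verts (hubs_graph r d) \<longleftrightarrow> i < r \<and> j < d"
  by (auto simp: hubs_graph_def)

lemma edges_hubs_graph:
  "{Hub i, Hub j} \<notin> edges (hubs_graph r d)"
  "{Hub i, Rim i' j b} \<in> edges (hubs_graph r d) \<longleftrightarrow> i = i' \<and> i < r \<and> j < d"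
  "{Rim i j b, Rim i' j' b'} \<in> edges (hubs_graph r d) \<longleftrightarrow> i = i' \<and> j = j' \<and> b \<noteq> b' \<and> i < r \<and> j < d"
  by (auto simp: hubs_graph_def doubleton_eq_iff)

lemma simple_graph_hubs_graph: "simple_graph (hubs_graph r d)"
proof -
  have "{Rim i j b | i j b. i < r \<and> j < d} = (\<lambda>(i, j, b). Rim i j b) ` ({..<r} \<times> {..<d} \<times> UNIV)"
    by (auto simp: image_iff)
  then have "finite (verts (hubs_graph r d))" by (simp add: hubs_graph_def)
  moreover have "\<forall>e\<in>edges (hubs_graph r d). e \<subseteq> verts (hubs_graph r d) \<and> card e = 2"
    by (auto simp: hubs_graph_def)
  ultimately show ?thesis by (simp add: simple_graph_def)
qed

text \<open>Rim edges form a matching, so a triangle contains a hub, and its other two vertices are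
  then the two ends of one rim edge. The bound caps the additive error that an algorithm is
  allowed.\<close>

lemma triangles_hubs_graph_le: "triangles (hubs_graph r d) \<le> r * d"
proof -
  let ?T = "{t. t \<subseteq> verts (hubs_graph r d) \<and> card t = 3 \<and>
     (\<forall>u\<in>t. \<forall>v\<in>t. u \<noteq> v \<longrightarrow> {u, v} \<in> edges (hubs_graph r d))}"
  have "?T \<subseteq> (\<lambda>(i, j). {Hub i, Rim i j False, Rim i j True}) ` ({..<r} \<times> {..<d})"
  proof
    fix t assume t: "t \<in> ?T"
    then obtain x y z where xyz: "t = {x, y, z}" "x \<noteq> y" "y \<noteq> z" "x \<noteq> z"
      by (auto simp: card_3_iff)
    have adj: "{x, y} \<in> edges (hubs_graph r d)" "{y, x} \<in> edges (hubs_graph r d)"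
      "{y, z} \<in> edges (hubs_graph r d)" "{z, y} \<in> edges (hubs_graph r d)"
      "{x, z} \<in> edges (hubs_graph r d)" "{z, x} \<in> edges (hubs_graph r d)"
      using t xyz by auto
    have hub: "{Hub i, Rim i j b, Rim i j (\<not> b)} = {Hub i, Rim i j False, Rim i j True}" for i j b
      by (cases b) auto
    have with_hub: "\<exists>i<r. \<exists>j<d. \<exists>s. {a, b, c} = {Hub i, Rim i j s, Rim i j (\<not> s)}"
      if "a = Hub i" "{a, b} \<in> edges (hubs_graph r d)" "{a, c} \<in> edges (hubs_graph r d)"
        "{b, c} \<in> edges (hubs_graph r d)" for a b c i
      using that by (cases b; cases c) (auto simp: edges_hubs_graph)
    have "\<exists>i<r. \<exists>j<d. \<exists>b. t = {Hub i, Rim i j b, Rim i j (\<not> b)}"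
    proof (cases x)
      case (Hub i)
      then show ?thesis using with_hub[of x i y z] adj xyz by simp
    next
      case x: (Rim i j b)
      show ?thesis
      proof (cases y)
        case (Hub i)
        then show ?thesis using with_hub[of y i x z] adj xyz by (simp add: insert_commute)
      next
        case y: (Rim i' j' b')
        show ?thesis
        proof (cases z)
          case (Hub i)
          then show ?thesis using with_hub[of z i x y] adj xyz by (simp add: insert_commute)
        next
          case (Rim i'' j'' b'')
          then show ?thesis using adj x y xyz(2-4) by (auto simp: edges_hubs_graph)
        qed
      qed
    qed
    then show "t \<in> (\<lambda>(i, j). {Hub i, Rim i j False, Rim i j True}) ` ({..<r} \<times> {..<d})"
      unfolding hub by auto
  qed
  then have "card ?T \<le> card ((\<lambda>(i, j). {Hub i, Rim i j False, Rim i j True}) ` ({..<r} \<times> {..<d}))"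
    by (intro card_mono) auto
  also have "\<dots> \<le> card ({..<r} \<times> {..<d})" by (intro card_image_le) auto
  finally show ?thesis by (simp add: triangles_def card_cartesian_product)
qed

lemma finite_triangles:
  assumes "finite (verts G)"
  shows "finite {t. t \<subseteq> verts G \<and> card t = 3 \<and> (\<forall>u\<in>t. \<forall>v\<in>t. u \<noteq> v \<longrightarrow> {u, v} \<in> edges G)}"
  by (rule finite_subset[of _ "Pow (verts G)"]) (use assms in auto)

lemma triangles_hubs_graph_pos:
  assumes "r \<ge> 1" "d \<ge> 1"
  shows "triangles (hubs_graph r d) > 0"
proof -
  have "{Hub 0, Rim 0 0 False, Rim 0 0 True} \<in> {t. t \<subseteq> verts (hubs_graph r d) \<and> card t = 3 \<and>
     (\<forall>u\<in>t. \<forall>v\<in>t. u \<noteq> v \<longrightarrow> {u, v} \<in> edges (hubs_graph r d))}"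
    using assms by (auto simp: verts_hubs_graph edges_hubs_graph insert_commute[of "Rim _ _ _" "Hub _"])
  moreover have "finite (verts (hubs_graph r d))"
    using simple_graph_hubs_graph[of r d] by (simp add: simple_graph_def)
  ultimately show ?thesis
    unfolding triangles_def by (intro card_gt_0_iff[THEN iffD2] conjI finite_triangles) blast
qed

section \<open>The gadget graphs\<close>

definition star_edges :: "nat \<Rightarrow> nat set \<Rightarrow> nat set \<Rightarrow> hub_vertex set set" where
  "star_edges r V Z = {{Hub i, Rim i u (u \<in> Z)} | i u. i < r \<and> u \<in> V}"

text \<open>The leaves of u are joined to those of v straight if the bit is \<open>False\<close> and
  crossed if it is \<open>True\<close>. So the leaves selected by Z at u and v are adjacent exactly
  when the bit is the parity of Z on the pair. Both edges are present whatever Z is, hence this part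
  of the stream is independent of Z.\<close>

definition pair_edges :: "nat \<Rightarrow> ((nat \<times> nat) \<times> bool) set \<Rightarrow> hub_vertex set set" where
  "pair_edges r T = {{Rim i u a, Rim i v (a \<noteq> w)} | i u v w a. i < r \<and> ((u, v), w) \<in> T}"

lemma star_pair_edges:
  "{Hub i, Hub j} \<notin> star_edges r V Z \<union> pair_edges r T"
  "{Hub i, Rim i' j b} \<in> star_edges r V Z \<union> pair_edges r T \<longleftrightarrow> i = i' \<and> i < r \<and> j \<in> V \<and> b = (j \<in> Z)"
  "{Rim i j b, Rim i' j' b'} \<in> star_edges r V Z \<union> pair_edges r T \<longleftrightarrow> i = i' \<and> i < r \<and>
     (((j, j'), b \<noteq> b') \<in> T \<or> ((j', j), b \<noteq> b') \<in> T)"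
proof -
  show "{Hub i, Hub j} \<notin> star_edges r V Z \<union> pair_edges r T"
    "{Hub i, Rim i' j b} \<in> star_edges r V Z \<union> pair_edges r T \<longleftrightarrow> i = i' \<and> i < r \<and> j \<in> V \<and> b = (j \<in> Z)"
    by (auto simp: star_edges_def pair_edges_def doubleton_eq_iff)
  have star: "{Rim i j b, Rim i' j' b'} \<notin> star_edges r V Z"
    by (auto simp: star_edges_def doubleton_eq_iff)
  have pair: "{Rim i j b, Rim i j' b'} \<in> pair_edges r T" if "i < r" "((j, j'), b \<noteq> b') \<in> T" for i j j' b b'
    unfolding pair_edges_def using that
    by (intro CollectI exI[of _ i] exI[of _ j] exI[of _ j'] exI[of _ "b \<noteq> b'"] exI[of _ b]) auto
  show "{Rim i j b, Rim i' j' b'} \<in> star_edges r V Z \<union> pair_edges r T \<longleftrightarrow> i = i' \<and> i < r \<and>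
     (((j, j'), b \<noteq> b') \<in> T \<or> ((j', j), b \<noteq> b') \<in> T)" (is "?l \<longleftrightarrow> ?r")
  proof
    assume ?l
    then have "{Rim i j b, Rim i' j' b'} \<in> pair_edges r T" using star by blast
    then show ?r by (auto simp: pair_edges_def doubleton_eq_iff)
  next
    assume r: ?r
    then have "{Rim i j b, Rim i j' b'} \<in> pair_edges r T"
    proof (elim conjE disjE)
      assume "i < r" "((j', j), b \<noteq> b') \<in> T"
      moreover from this have "((j', j), b' \<noteq> b) \<in> T" by (cases b; cases b') simp_all
      ultimately show ?thesis
        unfolding insert_commute[of "Rim i j b"] by (intro pair)
    qed (rule pair)
    then show ?l using r by simp
  qed
qed

text \<open>Every star edge contains a hub and no pair edge does. This is what makes the
  concatenation of the two stream parts free of repetitions.\<close>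

lemma star_pair_edges_disjoint: "star_edges r V Z \<inter> pair_edges r T = {}"
proof (rule ccontr)
  assume "star_edges r V Z \<inter> pair_edges r T \<noteq> {}"
  then obtain e where e: "e \<in> star_edges r V Z" "e \<in> pair_edges r T" by blast
  from e(1) obtain i where "Hub i \<in> e" unfolding star_edges_def by blast
  with e(2) show False unfolding pair_edges_def by blast
qed

lemma triangles_agreeing:
  fixes T :: "((nat \<times> nat) \<times> bool) set"
  assumes G_def: "G = (verts (hubs_graph r d), star_edges r V Z \<union> pair_edges r T)"
    and T: "T = (\<lambda>(u, v). ((u, v), (u \<in> Z) \<noteq> (v \<in> Z))) ` M" and M: "finite M" "M \<subseteq> L \<times> R"
    and LR: "L \<inter> R = {}" "V = L \<union> R" "V \<subseteq> {..<d}"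
  shows "triangles G \<ge> r * card M"
proof -
  define tri where "tri = (\<lambda>(i, u, v). {Hub i, Rim i u (u \<in> Z), Rim i v (v \<in> Z)})"
  let ?T = "{t. t \<subseteq> verts G \<and> card t = 3 \<and> (\<forall>u\<in>t. \<forall>v\<in>t. u \<noteq> v \<longrightarrow> {u, v} \<in> edges G)}"
  have inj: "inj_on tri ({..<r} \<times> M)"
  proof (rule inj_onI)
    fix p p' assume "p \<in> {..<r} \<times> M" "p' \<in> {..<r} \<times> M" and eq: "tri p = tri p'"
    then obtain i u v i' u' v' where p: "p = (i, u, v)" "p' = (i', u', v')"
      "u \<in> L" "v \<in> R" "u' \<in> L" "v' \<in> R" using M(2) by (cases p; cases p') auto
    have "Hub i \<in> tri p'" "Rim i u (u \<in> Z) \<in> tri p'" "Rim i v (v \<in> Z) \<in> tri p'"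
      unfolding eq[symmetric] by (auto simp: tri_def p)
    then show "p = p'" using p LR(1) by (auto simp: tri_def)
  qed
  have sub: "tri ` ({..<r} \<times> M) \<subseteq> ?T"
  proof (intro image_subsetI)
    fix p assume "p \<in> {..<r} \<times> M"
    then obtain i u v where p: "p = (i, u, v)" "i < r" "(u, v) \<in> M" "u \<in> L" "v \<in> R" using M by auto
    have uv: "u \<noteq> v" "u \<in> V" "v \<in> V" "u < d" "v < d" using p LR by auto
    have "((u, v), (u \<in> Z) \<noteq> (v \<in> Z)) \<in> T" using T p by (auto intro: image_eqI[of _ _ "(u, v)"])
    moreover from this have "((u, v), (v \<in> Z) \<noteq> (u \<in> Z)) \<in> T"
      by (cases "u \<in> Z"; cases "v \<in> Z") simp_all
    ultimately show "tri p \<in> ?T"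
      unfolding G_def using p uv
      by (auto simp: tri_def verts_hubs_graph star_pair_edges insert_commute[of "Rim _ _ _" "Hub _"]
          simp del: Un_iff)
  qed
  have "card (tri ` ({..<r} \<times> M)) \<le> card ?T"
    using simple_graph_hubs_graph[of r d]
    by (intro card_mono sub finite_triangles) (auto simp: G_def simple_graph_def)
  then show ?thesis by (simp add: card_image[OF inj] triangles_def card_cartesian_product)
qed

text \<open>A triangle through a hub would need an edge between two selected leaves, which forces a
  correct bit. A triangle without a hub would be an odd cycle in a graph that is bipartite between
  \<open>L\<close> and \<open>R\<close>.\<close>

lemma triangles_disagreeing:
  fixes T :: "((nat \<times> nat) \<times> bool) set"
  assumes G_def: "G = (W, star_edges r V Z \<union> pair_edges r T)"
    and T: "\<And>u v w. ((u, v), w) \<in> T \<Longrightarrow> u \<in> L \<and> v \<in> R \<and> w \<noteq> ((u \<in> Z) \<noteq> (v \<in> Z))"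
    and LR: "L \<inter> R = {}"
  shows "triangles G = 0"
proof -
  have "\<not> (card t = 3 \<and> (\<forall>u\<in>t. \<forall>v\<in>t. u \<noteq> v \<longrightarrow> {u, v} \<in> edges G))" for t
  proof
    assume t: "card t = 3 \<and> (\<forall>u\<in>t. \<forall>v\<in>t. u \<noteq> v \<longrightarrow> {u, v} \<in> edges G)"
    then obtain x y z where xyz: "t = {x, y, z}" "x \<noteq> y" "y \<noteq> z" "x \<noteq> z"
      by (auto simp: card_3_iff)
    have adj: "{x, y} \<in> edges G" "{y, x} \<in> edges G" "{y, z} \<in> edges G" "{z, y} \<in> edges G"
      "{x, z} \<in> edges G" "{z, x} \<in> edges G"
      using t xyz by auto
    have side: "(j \<in> L \<and> j' \<in> R \<or> j \<in> R \<and> j' \<in> L) \<and> (b \<noteq> b') \<noteq> ((j \<in> Z) \<noteq> (j' \<in> Z))"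
      if "{Rim i j b, Rim i' j' b'} \<in> edges G" for i j b i' j' b'
      using that T unfolding G_def snd_conv star_pair_edges by blast
    have hub: "b = (j \<in> Z)" if "{Hub i, Rim i' j b} \<in> edges G" for i i' j b
      using that unfolding G_def snd_conv star_pair_edges by blast
    have hubs: "{Hub i, Hub j} \<notin> edges G" for i j
      unfolding G_def snd_conv by (rule star_pair_edges)
    have no_hub: False
      if abc: "a = Hub i" "{a, b} \<in> edges G" "{a, c} \<in> edges G" "{b, c} \<in> edges G" for a b c i
    proof -
      obtain k j s k' j' s' where bc: "b = Rim k j s" "c = Rim k' j' s'"
        using abc hubs by (cases b; cases c) auto
      show False
        using abc side[of k j s k' j' s'] hub[of i k j s] hub[of i k' j' s'] unfolding bc by blast
    qed
    show False
    proof (cases "\<exists>i. x = Hub i \<or> y = Hub i \<or> z = Hub i")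
      case True
      then show False
        using no_hub[of x _ y z] no_hub[of y _ x z] no_hub[of z _ x y] adj by blast
    next
      case False
      then obtain i j b i' j' b' i'' j'' b''
        where "x = Rim i j b" "y = Rim i' j' b'" "z = Rim i'' j'' b''"
        by (cases x; cases y; cases z) auto
      then show False
        using adj LR side[of i j b i' j' b'] side[of i' j' b' i'' j'' b''] side[of i j b i'' j'' b'']
        by auto
    qed
  qed
  then have "{t. t \<subseteq> verts G \<and> card t = 3 \<and> (\<forall>u\<in>t. \<forall>v\<in>t. u \<noteq> v \<longrightarrow> {u, v} \<in> edges G)} = {}"
    by blast
  then show ?thesis unfolding triangles_def by (metis card.empty)
qed

text \<open>For each pair (u, v) with bit w, in every copy, the leaf of u labelled
  \<open>True\<close> is exchanged with the leaf of v labelled w. Of the two added edges, one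
  becomes the rim edge of v and the other the rim edge of u. Hubs stay fixed and no leaf changes its
  copy, so star edges remain hub edges. Nothing here depends on whether w is the parity.\<close>

lemma admissible_input_star_pair:
  assumes lab: "bij_betw lab (verts (hubs_graph r d)) {..<card (verts (hubs_graph r d))}"
    and LR: "L \<inter> R = {}" "V = L \<union> R" "V \<subseteq> {..<d}"
    and T: "\<And>u v w. ((u, v), w) \<in> T \<Longrightarrow> u \<in> L \<and> v \<in> R"
    and T1: "\<And>u v w v' w'. ((u, v), w) \<in> T \<Longrightarrow> ((u, v'), w') \<in> T \<Longrightarrow> v = v' \<and> w = w'"
    and T2: "\<And>u v w u' w'. ((u, v), w) \<in> T \<Longrightarrow> ((u', v), w') \<in> T \<Longrightarrow> u = u' \<and> w = w'"
  shows "admissible_input (hubs_graph r d)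
    (relabel lab (verts (hubs_graph r d), star_edges r V Z \<union> pair_edges r T))"
proof -
  define P where "P x y \<longleftrightarrow> (\<exists>i u v w. i < r \<and> ((u, v), w) \<in> T \<and>
      (x = Rim i u True \<and> y = Rim i v w \<or> y = Rim i u True \<and> x = Rim i v w))" for x y
  have sym: "P y x" if "P x y" for x y using that unfolding P_def by blast
  have unique: "y = z" if "P x y" "P x z" for x y z
  proof -
    obtain i u v w where 1: "((u, v), w) \<in> T" "x = Rim i u True \<and> y = Rim i v w \<or> y = Rim i u True \<and> x = Rim i v w"
      using \<open>P x y\<close> unfolding P_def by blast
    obtain i' u' v' w' where 2: "((u', v'), w') \<in> T" "x = Rim i' u' True \<and> z = Rim i' v' w' \<or> z = Rim i' u' True \<and> x = Rim i' v' w'"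
      using \<open>P x z\<close> unfolding P_def by blast
    show ?thesis using 1 2 T[OF 1(1)] T[OF 2(1)] T1[OF 1(1), of v' w'] T2[OF 1(1), of u' w'] LR(1)
      by auto
  qed
  have "\<exists>\<sigma>. (\<forall>x. \<sigma> (\<sigma> x) = x) \<and> (\<forall>x y. P x y \<longrightarrow> \<sigma> x = y) \<and> (\<forall>x. \<sigma> x \<noteq> x \<longrightarrow> P x (\<sigma> x))"
  proof (rule involution_of_matching)
    show "P y x" if "P x y" for x y by (rule sym[OF that])
    show "y = z" if "P x y" "P x z" for x y z by (rule unique[OF that])
  qed
  then obtain \<sigma> where \<sigma>: "\<And>x. \<sigma> (\<sigma> x) = x" "\<And>x y. P x y \<Longrightarrow> \<sigma> x = y" "\<And>x. \<sigma> x \<noteq> x \<Longrightarrow> P x (\<sigma> x)"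
    by blast
  have \<sigma>_Hub: "\<sigma> (Hub i) = Hub i" for i
    using \<sigma>(3)[of "Hub i"] unfolding P_def by blast
  have \<sigma>_Rim: "\<exists>j' b'. \<sigma> (Rim i j b) = Rim i j' b' \<and> j' < d" if "j < d" for i j b
  proof (cases "\<sigma> (Rim i j b) = Rim i j b")
    case False
    then obtain k u v w where "((u, v), w) \<in> T" "Rim i j b = Rim k u True \<and> \<sigma> (Rim i j b) = Rim k v w
        \<or> \<sigma> (Rim i j b) = Rim k u True \<and> Rim i j b = Rim k v w"
      using \<sigma>(3)[of "Rim i j b"] unfolding P_def by blast
    then show ?thesis using T[of u v w] LR by auto
  qed (use that in auto)
  show ?thesis
  proof (rule admissible_input_relabel[OF simple_graph_hubs_graph lab \<sigma>(1)])
    show "\<sigma> ` verts (hubs_graph r d) \<subseteq> verts (hubs_graph r d)"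
    proof (intro image_subsetI)
      fix x assume x: "x \<in> verts (hubs_graph r d)"
      show "\<sigma> x \<in> verts (hubs_graph r d)"
      proof (cases x)
        case (Rim i j b)
        then show ?thesis using x \<sigma>_Rim[of j i b] by (auto simp: verts_hubs_graph)
      qed (use x \<sigma>_Hub in auto)
    qed
    fix e assume "e \<in> star_edges r V Z \<union> pair_edges r T"
    then consider i u where "i < r" "u \<in> V" "e = {Hub i, Rim i u (u \<in> Z)}"
      | i u v w a where "i < r" "((u, v), w) \<in> T" "e = {Rim i u a, Rim i v (a \<noteq> w)}"
      by (auto simp: star_edges_def pair_edges_def)
    then show "\<sigma> ` e \<in> edges (hubs_graph r d)"
    proof cases
      case (1 i u)
      then have "u < d" using LR by blast
      then obtain j b where "\<sigma> (Rim i u (u \<in> Z)) = Rim i j b" "j < d" using \<sigma>_Rim by blast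
      then show ?thesis using 1 by (simp add: \<sigma>_Hub edges_hubs_graph)
    next
      case (2 i u v w a)
      have uv: "u \<in> L" "v \<in> R" "u < d" "v < d" using T[OF 2(2)] LR by auto
      have "P (Rim i u True) (Rim i v w)" unfolding P_def using 2 by blast
      note s = \<sigma>(2)[OF this] \<sigma>(2)[OF sym[OF this]]
      \<comment> \<open>The other ends of the two added edges must stay in place. On the
        \<open>L\<close> side only leaves labelled \<open>True\<close> move; on the \<open>R\<close>
        side v belongs to a single pair, so only its leaf labelled w moves.\<close>
      have F: "\<sigma> (Rim i u False) = Rim i u False"
      proof (rule ccontr)
        assume "\<sigma> (Rim i u False) \<noteq> Rim i u False"
        from \<sigma>(3)[OF this] obtain u' v' w' where "((u', v'), w') \<in> T" "u = v'"
          unfolding P_def by blast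
        then show False using T[of u' v' w'] uv LR(1) by blast
      qed
      have N: "\<sigma> (Rim i v (\<not> w)) = Rim i v (\<not> w)"
      proof (rule ccontr)
        assume "\<sigma> (Rim i v (\<not> w)) \<noteq> Rim i v (\<not> w)"
        from \<sigma>(3)[OF this] obtain u' v' w' where "((u', v'), w') \<in> T" "v = u' \<or> v = v' \<and> w' = (\<not> w)"
          unfolding P_def by blast
        then show False using T[of u' v' w'] T2[OF 2(2), of u' w'] uv LR(1) by blast
      qed
      show ?thesis
      proof (cases a)
        case True
        then show ?thesis using 2 s N uv by (simp add: edges_hubs_graph)
      next
        case False
        then show ?thesis using 2 s F uv by (simp add: edges_hubs_graph)
      qed
    qed
  qed
qed

section \<open>Streaming algorithms as protocols\<close>

text \<open>\<open>instopt\<close> is a \<open>LEAST\<close>, which yields a solver only if some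
  space bound is attainable at all. The witness stores the whole set of edges seen so far; a unary
  code suffices, because only finiteness of the bound matters.\<close>

lemma ex_solver:
  fixes G :: "'a graph"
  assumes "\<epsilon> \<ge> 0" "\<delta> \<ge> 0"
  shows "\<exists>S P. solves P G S \<epsilon> \<delta>"
proof -
  define N where "N = card (verts G)"
  define U where "U = Pow (Pow {..<N})"
  have U: "finite U" by (simp add: U_def)
  obtain f :: "nat set set \<Rightarrow> nat" where f: "inj_on f U"
    using finite_imp_inj_to_nat_seg[OF U] by blast
  define enc where "enc E = replicate (f E) True" for E
  have inj: "inj_on enc U"
    using f by (auto simp: inj_on_def enc_def)
  define dec where "dec = inv_into U enc"
  have dec: "dec (enc E) = E" if "E \<in> U" for E
    using inj that by (simp add: dec_def)
  define A where "A = \<lparr>init = enc {}, update = (\<lambda>m e. enc (insert e (dec m))),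
    estimate = (\<lambda>m. real (triangles ({..<N}, dec m)))\<rparr>"
  have mem: "memory_after A es = enc (set es)" if "set es \<subseteq> Pow {..<N}" for es
    using that
  proof (induction es rule: rev_induct)
    case (snoc e es)
    then have "set es \<in> U" by (auto simp: U_def)
    then show ?case using snoc by (simp add: memory_after_def A_def dec)
  qed (simp add: memory_after_def A_def)
  define S where "S = Max ((length \<circ> enc) ` U)"
  have "solves (return_pmf A) G S \<epsilon> \<delta>"
    unfolding solves_def
  proof (intro allI impI, elim conjE)
    fix G' es assume adm: "admissible_input G G'" and es: "insertion_stream G' es"
    from adm obtain H h where H: "subgraph H G" "bij_betw h (verts H) (verts G')"
      "edges G' = (\<lambda>e. h ` e) ` edges H" and V: "verts G' \<subseteq> {..<N}"
      unfolding admissible_input_def graph_iso_def N_def by blast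
    have E: "e \<subseteq> verts G'" if e: "e \<in> edges G'" for e
    proof -
      obtain e' where "e' \<in> edges H" "e = h ` e'" using H(3) e by auto
      then show ?thesis using H(1,2) by (auto simp: subgraph_def simple_graph_def bij_betw_def)
    qed
    have set_es: "set es = edges G'" using es by (simp add: insertion_stream_def)
    have sub: "set es \<subseteq> Pow {..<N}" using E V set_es by blast
    \<comment> \<open>The algorithm does not see the vertex set and counts triangles in the whole
      label universe. This is harmless, since each vertex of a triangle lies on an edge and thus in
      the input graph.\<close>
    have "t \<subseteq> verts G'" if t: "card t = 3" "\<forall>u\<in>t. \<forall>v\<in>t. u \<noteq> v \<longrightarrow> {u, v} \<in> edges G'" for t
    proof
      fix u assume u: "u \<in> t"
      have "\<not> t \<subseteq> {u}" using t(1) card_mono[of "{u}" t] by auto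
      then obtain v where v: "v \<in> t" "u \<noteq> v" by auto
      have "{u, v} \<in> edges G'" by (rule t(2)[rule_format, OF u v])
      from E[OF this] show "u \<in> verts G'" by simp
    qed
    then have "{t. t \<subseteq> {..<N} \<and> card t = 3 \<and> (\<forall>u\<in>t. \<forall>v\<in>t. u \<noteq> v \<longrightarrow> {u, v} \<in> edges G')}
      = {t. t \<subseteq> verts G' \<and> card t = 3 \<and> (\<forall>u\<in>t. \<forall>v\<in>t. u \<noteq> v \<longrightarrow> {u, v} \<in> edges G')}"
      using V by blast
    then have "triangles ({..<N}, edges G') = triangles G'"
      unfolding triangles_def fst_conv snd_conv by (rule arg_cong)
    moreover have "dec (enc (set es)) = set es" by (rule dec) (use sub in \<open>simp add: U_def\<close>)
    ultimately have ans: "answer A es = real (triangles G')"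
      unfolding answer_def mem[OF sub] set_es by (simp add: A_def)
    have "space_used A es \<le> S"
      unfolding space_used_def
    proof (intro Max.boundedI)
      fix s assume "s \<in> (\<lambda>k. length (memory_after A (take k es))) ` {..length es}"
      then obtain k where k: "s = length (memory_after A (take k es))" by auto
      have sub': "set (take k es) \<subseteq> Pow {..<N}" using sub set_take_subset[of k es] by blast
      then have "set (take k es) \<in> U" by (simp add: U_def)
      then show "s \<le> S" unfolding k mem[OF sub'] S_def using U by (intro Max_ge) auto
    qed auto
    then show "1 - \<delta> \<le> measure_pmf.prob (return_pmf A)
        {A. \<bar>answer A es - real (triangles G')\<bar> \<le> \<epsilon> * real (triangles G)} \<and>
      (\<forall>A\<in>set_pmf (return_pmf A). space_used A es \<le> S)"
      using assms by (simp add: ans)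
  qed
  then show ?thesis by blast
qed

section \<open>Memory as a message, and the space bound for a solver\<close>

lemma length_memory_after_le: "length (memory_after A xs) \<le> space_used A (xs @ ys)"
  unfolding space_used_def
  by (rule Max_ge) (auto intro!: image_eqI[of _ _ "length xs"])

lemma memory_after_append: "memory_after A (xs @ ys) = foldl (update A) (memory_after A xs) ys"
  by (simp add: memory_after_def)

lemma expectation_mean:
  fixes f :: "'b \<Rightarrow> 'a \<Rightarrow> real"
  assumes "\<And>x. x \<in> S \<Longrightarrow> integrable (measure_pmf P) (f x)"
  shows "integrable (measure_pmf P) (\<lambda>A. mean S (\<lambda>x. f x A))"
    and "measure_pmf.expectation P (\<lambda>A. mean S (\<lambda>x. f x A)) = mean S (\<lambda>x. measure_pmf.expectation P (f x))"
  using assms by (auto simp: mean_def)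

lemma ex_in_both_events:
  fixes P :: "'a pmf"
  assumes "measure_pmf.prob P X + measure_pmf.prob P Y > 1"
  shows "\<exists>A\<in>set_pmf P. A \<in> X \<and> A \<in> Y"
proof (rule ccontr)
  assume *: "\<not> ?thesis"
  have "measure_pmf.prob P X \<le> measure_pmf.prob P (- Y)"
  proof (rule measure_pmf.finite_measure_mono_AE)
    show "AE x in measure_pmf P. x \<in> X \<longrightarrow> x \<in> - Y" using * by (auto simp: AE_measure_pmf_iff)
  qed auto
  also have "\<dots> = 1 - measure_pmf.prob P Y"
    using measure_pmf.prob_compl[of Y P] by (simp add: Compl_eq_Diff_UNIV)
  finally show False using assms by simp
qed

text \<open>Fixing one order per edge set makes each part of the stream a function of the input of
  its own party.\<close>

definition some_stream :: "nat set set \<Rightarrow> nat set list" where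
  "some_stream E = (SOME es. set es = E \<and> distinct es)"

lemma some_stream:
  assumes "finite E"
  shows "distinct (some_stream E)" "set (some_stream E) = E"
  using someI_ex[OF finite_distinct_list[OF assms]] unfolding some_stream_def by blast+

lemma card_bool_lists_le: "card {xs :: bool list. length xs \<le> S} \<le> 2 ^ Suc S"
proof -
  have "card {xs :: bool list. length xs \<le> S} = (\<Sum>i\<le>S. 2 ^ i)"
    using card_lists_length_le[of "UNIV :: bool set" S] by simp
  also have "\<dots> \<le> 2 ^ Suc S" by (induction S) auto
  finally show ?thesis .
qed

lemma zip_matching_facts:
  assumes es: "es \<in> matchings k L R" and ws: "length ws = k"
  shows "((u, v), w) \<in> set (zip es ws) \<Longrightarrow> u \<in> L \<and> v \<in> R"
    and "((u, v), w) \<in> set (zip es ws) \<Longrightarrow> ((u, v'), w') \<in> set (zip es ws) \<Longrightarrow> v = v' \<and> w = w'"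
    and "((u, v), w) \<in> set (zip es ws) \<Longrightarrow> ((u', v), w') \<in> set (zip es ws) \<Longrightarrow> u = u' \<and> w = w'"
proof -
  have len: "length es = k" and d: "distinct (map fst es)" "distinct (map snd es)" and sub: "set es \<subseteq> L \<times> R"
    using es by (auto simp: matchings_def)
  show "u \<in> L \<and> v \<in> R" if "((u, v), w) \<in> set (zip es ws)"
    using set_zip_leftD[OF that] sub by blast
  show "v = v' \<and> w = w'" if a: "((u, v), w) \<in> set (zip es ws)" and b: "((u, v'), w') \<in> set (zip es ws)"
  proof -
    obtain i j where ij: "i < k" "es ! i = (u, v)" "ws ! i = w" "j < k" "es ! j = (u, v')" "ws ! j = w'"
      using a b len ws by (auto simp: set_zip)
    then have "map fst es ! i = map fst es ! j" using len by simp
    then have "i = j" using d(1) ij len by (subst (asm) nth_eq_iff_index_eq) auto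
    then show ?thesis using ij by simp
  qed
  show "u = u' \<and> w = w'" if a: "((u, v), w) \<in> set (zip es ws)" and b: "((u', v), w') \<in> set (zip es ws)"
  proof -
    obtain i j where ij: "i < k" "es ! i = (u, v)" "ws ! i = w" "j < k" "es ! j = (u', v)" "ws ! j = w'"
      using a b len ws by (auto simp: set_zip)
    then have "map snd es ! i = map snd es ! j" using len by simp
    then have "i = j" using d(2) ij len by (subst (asm) nth_eq_iff_index_eq) auto
    then show ?thesis using ij by simp
  qed
qed

lemma set_zip_parities:
  "set (zip es (parities es Z)) = (\<lambda>(u, v). ((u, v), (u \<in> Z) \<noteq> (v \<in> Z))) ` set es"
  by (induction es) (auto simp: parities_def)

lemma set_zip_Not_parities:
  "set (zip es (map Not (parities es Z))) = (\<lambda>(u, v). ((u, v), \<not> ((u \<in> Z) \<noteq> (v \<in> Z)))) ` set es"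
  by (induction es) (auto simp: parities_def)

lemma solvesD:
  assumes "solves P G S \<epsilon> \<delta>" "admissible_input G G'" "insertion_stream G' es"
  shows "1 - \<delta> \<le> measure_pmf.prob P
      {A. \<bar>answer A es - real (triangles G')\<bar> \<le> \<epsilon> * real (triangles G)}"
    and "A \<in> set_pmf P \<Longrightarrow> space_used A es \<le> S"
  using assms unfolding solves_def by blast+

text \<open>Without memory the final state is empty for every stream, so the full hubs graph and the
  edgeless graph receive the same answer. As 9/10 + 9/10 exceeds 1, some outcome of the coins is
  accurate on both, which is impossible for \<epsilon> below 1/2. The bound settles small d and
  later absorbs additive constants into S.\<close>

lemma solves_space_pos:
  assumes solves: "solves P (hubs_graph r d) S \<epsilon> (1/10)" and r: "r \<ge> 1" "d \<ge> 1"
    and \<epsilon>: "\<epsilon> < 1 / 2"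
  shows "S \<ge> 1"
proof (rule ccontr)
  assume "\<not> S \<ge> 1"
  then have S: "S = 0" by simp
  let ?G = "hubs_graph r d"
  have simple: "simple_graph ?G" by (rule simple_graph_hubs_graph)
  then have fin: "finite (verts ?G)" by (simp add: simple_graph_def)
  obtain lab where lab: "bij_betw lab (verts ?G) {..<card (verts ?G)}"
    using ex_bij_betw_finite_nat[OF fin] by (auto simp: atLeast0LessThan)
  define G1 where "G1 = relabel lab (verts ?G, edges ?G)"
  define G0 where "G0 = relabel lab (verts ?G, {})"
  have sub: "e \<subseteq> verts ?G" if "e \<in> edges ?G" for e using simple that by (auto simp: simple_graph_def)
  have adm: "admissible_input ?G G1" "admissible_input ?G G0"
    unfolding G1_def G0_def
    by (rule admissible_input_relabel[OF simple lab, where \<sigma> = "\<lambda>x. x"]; simp)+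
  have "edges ?G \<subseteq> Pow (verts ?G)" using sub by blast
  then have "finite (edges ?G)" using fin by (simp add: finite_subset)
  then have "finite (edges G1)" by (simp add: G1_def relabel_def)
  note st = some_stream[OF this]
  have ins: "insertion_stream G1 (some_stream (edges G1))" "insertion_stream G0 []"
    using st by (auto simp: insertion_stream_def G0_def relabel_def)
  have T: "triangles G1 = triangles ?G" "triangles G0 = 0"
  proof -
    show "triangles G1 = triangles ?G"
      using triangles_relabel[of lab "(verts ?G, edges ?G)"] lab sub by (simp add: G1_def bij_betw_def)
    have "{t :: nat set. t \<subseteq> verts G0 \<and> card t = 3 \<and> (\<forall>u\<in>t. \<forall>v\<in>t. u \<noteq> v \<longrightarrow> {u, v} \<in> edges G0)} = {}"
      unfolding G0_def relabel_def snd_conv image_empty card_3_iff by blast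
    then show "triangles G0 = 0" unfolding triangles_def by (simp only: card.empty)
  qed
  define t where "t = real (triangles ?G)"
  have t: "t > 0" using triangles_hubs_graph_pos[OF r] by (simp add: t_def)
  have p1: "1 - 1/10 \<le> measure_pmf.prob P {A. \<bar>answer A (some_stream (edges G1)) - t\<bar> \<le> \<epsilon> * t}"
    "\<forall>A\<in>set_pmf P. space_used A (some_stream (edges G1)) \<le> 0"
    using solvesD[OF solves adm(1) ins(1)] unfolding S t_def T(1) by blast+
  have p0: "1 - 1/10 \<le> measure_pmf.prob P {A. \<bar>answer A [] - 0\<bar> \<le> \<epsilon> * t}"
    "\<forall>A\<in>set_pmf P. space_used A [] \<le> 0"
    using solvesD[OF solves adm(2) ins(2)] unfolding S t_def T(2) of_nat_0 by blast+
  obtain A where A: "A \<in> set_pmf P" "\<bar>answer A (some_stream (edges G1)) - t\<bar> \<le> \<epsilon> * t" "\<bar>answer A []\<bar> \<le> \<epsilon> * t"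
    using ex_in_both_events[of P "{A. \<bar>answer A (some_stream (edges G1)) - t\<bar> \<le> \<epsilon> * t}" "{A. \<bar>answer A [] - 0\<bar> \<le> \<epsilon> * t}"]
      p1(1) p0(1) by auto
  have "memory_after A (some_stream (edges G1)) = []" "memory_after A [] = []"
    using length_memory_after_le[of A "some_stream (edges G1)" "[]"] length_memory_after_le[of A "[]" "[]"]
      p1(2) p0(2) A(1) by auto
  then have "answer A (some_stream (edges G1)) = answer A []" by (simp add: answer_def)
  then have "t \<le> 2 * \<epsilon> * t" using A(2,3) by linarith
  then show False using t \<epsilon> by simp
qed

lemma solves_space_ge:
  assumes solves: "solves P (hubs_graph r d) S \<epsilon> (1/10)" and r: "r \<ge> 1" and d: "d \<ge> 4"
    and \<epsilon>: "0 < \<epsilon>" "\<epsilon> \<le> 1/20"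
  shows "real d \<le> 3675 * (real S)\<^sup>2"
proof -
  \<comment> \<open>Each of the 2n coordinates uses its own leaf pair among the d of a copy. The
    choice of k is linear in d, yet leaves n - k at least k, so that \<open>q\<close> can be k^2. In
    the bound d \<le> 7k the worst case is d = 7.\<close>
  define n k where "n = d div 2" and "k = d div 4"
  define L R V where "L = {..<n}" and "R = {n..<2 * n}" and "V = L \<union> R"
  have k: "k \<ge> 1" "k \<le> n" "k \<le> n - k" using d by (auto simp: n_def k_def)
  have kd: "real d \<le> 7 * real k" "4 * real k \<le> real d"
  proof -
    have "d \<le> 7 * k" "4 * k \<le> d" using d unfolding k_def by presburger+
    then show "real d \<le> 7 * real k" "4 * real k \<le> real d" by linarith+
  qed
  have LR: "finite L" "finite R" "L \<inter> R = {}" "card L = card R" "card L = n" "V \<subseteq> {..<d}"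
    by (auto simp: L_def R_def V_def n_def)
  let ?G = "hubs_graph r d"
  have simple: "simple_graph ?G" by (rule simple_graph_hubs_graph)
  then have fin: "finite (verts ?G)" by (simp add: simple_graph_def)
  obtain lab where lab: "bij_betw lab (verts ?G) {..<card (verts ?G)}"
    using ex_bij_betw_finite_nat[OF fin] by (auto simp: atLeast0LessThan)
  have inj: "inj_on lab (verts ?G)" using lab by (simp add: bij_betw_def)
  define alice where "alice Z = some_stream ((`) lab ` star_edges r V Z)" for Z
  define bob where "bob es ws = some_stream ((`) lab ` pair_edges r (set (zip es ws)))" for es ws
  define G' where "G' Z T = (verts ?G, star_edges r V Z \<union> pair_edges r T)" for Z T
  have sub: "e \<subseteq> verts ?G" if e: "e \<in> star_edges r V Z \<union> pair_edges r (set (zip es ws))"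
    and m: "es \<in> matchings k L R" "length ws = k" for e Z es ws
  proof -
    consider i u where "i < r" "u \<in> V" "e = {Hub i, Rim i u (u \<in> Z)}"
      | i u v w a where "i < r" "((u, v), w) \<in> set (zip es ws)" "e = {Rim i u a, Rim i v (a \<noteq> w)}"
      using e unfolding star_edges_def pair_edges_def by blast
    then show ?thesis
    proof cases
      case (1 i u)
      then have "u < d" using LR(6) by blast
      then show ?thesis using 1 by (simp add: verts_hubs_graph)
    next
      case (2 i u v w a)
      then have "u < d" "v < d" using zip_matching_facts(1)[OF m 2(2)] LR(6) by (auto simp: V_def)
      then show ?thesis using 2 by (simp add: verts_hubs_graph)
    qed
  qed
  have input: "admissible_input ?G (relabel lab (G' Z (set (zip es ws))))"
      "insertion_stream (relabel lab (G' Z (set (zip es ws)))) (alice Z @ bob es ws)"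
      "triangles (relabel lab (G' Z (set (zip es ws)))) = triangles (G' Z (set (zip es ws)))"
    if es: "es \<in> matchings k L R" and ws: "length ws = k" for Z es ws
  proof -
    show "admissible_input ?G (relabel lab (G' Z (set (zip es ws))))"
      unfolding G'_def using zip_matching_facts[OF es ws] LR(3,6)
      by (intro admissible_input_star_pair[OF lab, where L = L and R = R]) (auto simp: V_def)
    show "triangles (relabel lab (G' Z (set (zip es ws)))) = triangles (G' Z (set (zip es ws)))"
      using inj sub[OF _ es ws] by (intro triangles_relabel) (auto simp: G'_def)
    have fins: "finite (star_edges r V Z)" "finite (pair_edges r (set (zip es ws)))"
      using sub[OF _ es ws, of _ Z] fin by (auto intro!: finite_subset[of _ "Pow (verts ?G)"])
    have "inj_on ((`) lab) (star_edges r V Z \<union> pair_edges r (set (zip es ws)))"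
      using sub[OF _ es ws] by (intro inj_on_subset[OF inj_on_image_Pow[OF inj]]) blast
    then have "(`) lab ` star_edges r V Z \<inter> (`) lab ` pair_edges r (set (zip es ws)) = {}"
      using star_pair_edges_disjoint[of r V Z] by (simp add: inj_on_image_Int[symmetric])
    then show "insertion_stream (relabel lab (G' Z (set (zip es ws)))) (alice Z @ bob es ws)"
      using some_stream fins
      by (simp add: insertion_stream_def relabel_def G'_def alice_def bob_def image_Un)
  qed
  define t where "t = real (triangles ?G)"
  have t: "t \<le> real r * real d" using triangles_hubs_graph_le[of r d] by (simp add: t_def flip: of_nat_mult)
  \<comment> \<open>With \<epsilon> at most 1/20 and d at most 7k the error is at most 7/20 of r k.
    So the threshold r k / 2 separates at least r k triangles from none.\<close>
  have gap: "\<epsilon> * t < real r * real k / 2"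
  proof -
    have "\<epsilon> * t \<le> (1/20) * (real r * real d)" using \<epsilon> t by (intro mult_mono) (auto simp: t_def)
    also have "\<dots> \<le> (1/20) * (real r * (7 * real k))" using kd by (intro mult_left_mono) auto
    also have "\<dots> < real r * real k / 2" using r k by simp
    finally show ?thesis .
  qed
  define msg where "msg A Z = memory_after A (alice Z)" for A :: stream_alg and Z
  define acc where "acc A m es ws \<longleftrightarrow> estimate A (foldl (update A) m (bob es ws)) \<ge> real r * real k / 2" for A :: stream_alg and m es ws
  define dec where "dec A m es ws = (of_bool (acc A m es ws) :: real)" for A :: stream_alg and m es ws
  have ans: "answer A (alice Z @ bob es ws) = estimate A (foldl (update A) (msg A Z) (bob es ws))"
    for A :: stream_alg and Z es ws
    by (simp add: answer_def memory_after_append msg_def)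
  have prob: "9/10 \<le> measure_pmf.prob P {A. \<bar>answer A (alice Z @ bob es ws)
        - real (triangles (G' Z (set (zip es ws))))\<bar> \<le> \<epsilon> * t}"
    and space: "\<forall>A\<in>set_pmf P. space_used A (alice Z @ bob es ws) \<le> S"
    if "es \<in> matchings k L R" "length ws = k" for Z es ws
    using solvesD[OF solves input(1,2)[OF that, of Z]] unfolding t_def input(3)[OF that] by auto
  have len: "length (parities es Z) = k" "length (map Not (parities es Z)) = k" if "es \<in> matchings k L R" for es Z
    using that by (auto simp: matchings_def)
  have yes: "9/10 \<le> measure_pmf.prob P {A. acc A (msg A Z) es (parities es Z)}"
    if es: "es \<in> matchings k L R" for es Z
  proof -
    have "card (set es) = k" using es by (auto simp: matchings_def distinct_map distinct_card)
    moreover have "triangles (G' Z (set (zip es (parities es Z)))) \<ge> r * card (set es)"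
      using es LR by (intro triangles_agreeing[OF _ set_zip_parities, where V = V and L = L and R = R])
        (auto simp: G'_def V_def matchings_def)
    ultimately have "real r * real k \<le> real (triangles (G' Z (set (zip es (parities es Z)))))"
      by (simp flip: of_nat_mult)
    then have "{A. \<bar>answer A (alice Z @ bob es (parities es Z))
        - real (triangles (G' Z (set (zip es (parities es Z)))))\<bar> \<le> \<epsilon> * t} \<subseteq> {A. acc A (msg A Z) es (parities es Z)}"
      using gap by (auto simp: acc_def ans)
    from order_trans[OF prob[OF es len(1)[OF es]] measure_pmf.finite_measure_mono[OF this]]
    show ?thesis by simp
  qed
  have no: "measure_pmf.prob P {A. acc A (msg A Z) es (map Not (parities es Z))} \<le> 1/10"
    if es: "es \<in> matchings k L R" for es Z
  proof -
    let ?ws = "map Not (parities es Z)"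
    have "triangles (G' Z (set (zip es ?ws))) = 0"
      using zip_matching_facts(1)[OF es len(2)[OF es]] LR(3) unfolding G'_def
      by (intro triangles_disagreeing[OF refl, of _ L R]) (auto simp: set_zip_Not_parities)
    then have "{A. \<bar>answer A (alice Z @ bob es ?ws) - real (triangles (G' Z (set (zip es ?ws))))\<bar> \<le> \<epsilon> * t}
       \<subseteq> - {A. acc A (msg A Z) es ?ws}"
      using gap by (auto simp: acc_def ans)
    from order_trans[OF prob[OF es len(2)[OF es]] measure_pmf.finite_measure_mono[OF this]]
    have "9/10 \<le> measure_pmf.prob P (- {A. acc A (msg A Z) es ?ws})" by simp
    then show ?thesis
      using measure_pmf.prob_compl[of "{A. acc A (msg A Z) es ?ws}" P] by (simp add: Compl_eq_Diff_UNIV)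
  qed
  define Ms where "Ms = {xs :: bool list. length xs \<le> S}"
  have Ms: "finite Ms" unfolding Ms_def using finite_lists_length_le[of "UNIV :: bool set" S] by simp
  have M: "finite (matchings k L R)" "matchings k L R \<noteq> {}"
    using LR k finite_matchings[of L R k] matchings_nonempty[of L R k] by simp_all
  have msg: "msg A Z \<in> Ms" if "A \<in> set_pmf P" for A Z
  proof -
    obtain es where es: "es \<in> matchings k L R" using M by blast
    show ?thesis
      using space[OF es len(1)[OF es], of Z Z] that length_memory_after_le[of A "alice Z"]
      unfolding msg_def Ms_def by (force intro: order_trans)
  qed
  define K where "K = real k * (4 / real (k\<^sup>2)) * (1 + ln (real (card Ms)))\<^sup>2"
  define adv where "adv es Z A = dec A (msg A Z) es (parities es Z) - dec A (msg A Z) es (map Not (parities es Z))" for es Z A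
  \<comment> \<open>Here \<tau> = 1/10, so 1/(2\<tau>) = 5 and 2\<tau> = 1/5. Against the advantage
    9/10 - 1/10 of a solver this leaves 6/10 \<le> 5K.\<close>
  have upper: "mean (matchings k L R) (\<lambda>es. mean (Pow V) (\<lambda>Z. adv es Z A)) \<le> 5 * K + 1/5"
    if A: "A \<in> set_pmf P" for A
  proof -
    have "real (k\<^sup>2) \<le> real ((card L - k)\<^sup>2)"
      using k LR by (intro of_nat_mono power_mono) auto
    from hidden_matching_advantage_le[where L = L and R = R and k = k and q = "real (k\<^sup>2)" and \<tau> = "1/10"
        and Ms = Ms and msg = "msg A" and dec = "dec A", OF LR(1-4) _ _ this]
    show ?thesis
      using k LR Ms msg[OF A] by (simp add: dec_def adv_def V_def K_def)
  qed
  have ind: "dec A (msg A Z) es ws = indicator {A. acc A (msg A Z) es ws} A" for A Z es ws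
    by (simp add: dec_def indicator_def)
  have integ: "integrable (measure_pmf P) (\<lambda>A. dec A (msg A Z) es ws)" for Z es ws
    unfolding dec_def by (intro measure_pmf.integrable_const_bound[where B = 1]) auto
  have integ_adv: "integrable (measure_pmf P) (adv es Z)" for es Z
    unfolding adv_def by (intro Bochner_Integration.integrable_diff integ)
  have lower: "8/10 \<le> measure_pmf.expectation P (adv es Z)" if "es \<in> matchings k L R" for es Z
  proof -
    have "measure_pmf.expectation P (adv es Z) = measure_pmf.prob P {A. acc A (msg A Z) es (parities es Z)}
       - measure_pmf.prob P {A. acc A (msg A Z) es (map Not (parities es Z))}"
      unfolding adv_def by (subst Bochner_Integration.integral_diff[OF integ integ]) (simp add: ind)
    then show ?thesis using yes[OF that, of Z] no[OF that, of Z] by simp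
  qed
  have PV: "finite (Pow V)" "Pow V \<noteq> {}" using LR by (auto simp: V_def)
  \<comment> \<open>The lower bound holds for each input on average over the coins, the upper bound
    for each outcome of the coins on average over the inputs. Exchanging the two averages confronts
    them.\<close>
  have "8/10 = mean (matchings k L R) (\<lambda>es. mean (Pow V) (\<lambda>Z. 8/10))"
    using M PV by (simp add: mean_const)
  also have "\<dots> \<le> mean (matchings k L R) (\<lambda>es. mean (Pow V) (\<lambda>Z. measure_pmf.expectation P (adv es Z)))"
    by (intro mean_mono lower)
  also have "\<dots> = measure_pmf.expectation P (\<lambda>A. mean (matchings k L R) (\<lambda>es. mean (Pow V) (\<lambda>Z. adv es Z A)))"
    by (simp add: expectation_mean integ_adv)
  also have "\<dots> \<le> 5 * K + 1/5"
    using upper by (intro measure_pmf.integral_le_const expectation_mean integ_adv) (simp add: AE_measure_pmf_iff)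
  finally have K: "12/100 \<le> K" by simp
  have ln: "1 + ln (real (card Ms)) \<le> real S + 2" "0 \<le> 1 + ln (real (card Ms))"
  proof -
    have "[] \<in> Ms" by (simp add: Ms_def)
    then have c: "card Ms \<ge> 1" using Ms by (metis One_nat_def Suc_leI card_gt_0_iff empty_iff)
    have "real (card Ms) \<le> 2 ^ Suc S"
      using card_bool_lists_le[of S] unfolding Ms_def by (metis of_nat_le_iff of_nat_numeral of_nat_power)
    then have "ln (real (card Ms)) \<le> ln (2 ^ Suc S)" using c by (subst ln_le_cancel_iff) auto
    also have "\<dots> = real (Suc S) * ln 2" by (subst ln_realpow) auto
    also have "\<dots> \<le> real (Suc S) * 1" using ln_2_less_1 by (intro mult_left_mono) auto
    finally show "1 + ln (real (card Ms)) \<le> real S + 2" by simp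
    show "0 \<le> 1 + ln (real (card Ms))" using c by simp
  qed
  have S: "S \<ge> 1" using solves_space_pos[OF solves r] d \<epsilon> by simp
  have "12/100 * real k \<le> K * real k" using K by (intro mult_right_mono) auto
  also have "\<dots> = 4 * (1 + ln (real (card Ms)))\<^sup>2" using k by (simp add: K_def power2_eq_square)
  also have "\<dots> \<le> 4 * (real S + 2)\<^sup>2" using ln by (intro mult_left_mono power_mono) auto
  \<comment> \<open>S + 2 \<le> 3S because S is at least 1. Then k \<le> 300 S^2, and d \<le> 7k
    gives 2100 S^2, within the stated constant.\<close>
  also have "\<dots> \<le> 4 * (3 * real S)\<^sup>2" using S by (intro mult_left_mono power_mono) auto
  finally have "real k \<le> 300 * (real S)\<^sup>2" by (simp add: power_mult_distrib)
  then show ?thesis using kd by (smt (verit) zero_le_power2)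
qed

theorem mainTheorem6:
  "\<exists>\<epsilon>\<^sub>0>0. \<forall>\<epsilon>::real. 0 < \<epsilon> \<and> \<epsilon> \<le> \<epsilon>\<^sub>0 \<longrightarrow>
     (\<exists>c::real. c > 0 \<and>
        (\<forall>r d :: nat. r \<ge> 1 \<and> d \<ge> 1 \<longrightarrow>
           real (instopt (hubs_graph r d) \<epsilon> (1/10)) \<ge> c * sqrt (real d)))"
proof -
  have main: "real (instopt (hubs_graph r d) \<epsilon> (1/10)) \<ge> 1/100 * sqrt (real d)"
    if \<epsilon>: "0 < \<epsilon>" "\<epsilon> \<le> 1/20" and rd: "r \<ge> 1" "d \<ge> 1" for \<epsilon> :: real and r d :: nat
  proof -
    define S where "S = instopt (hubs_graph r d) \<epsilon> (1/10)"
    obtain P where P: "solves P (hubs_graph r d) S \<epsilon> (1/10)"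
      using LeastI_ex[OF ex_solver[of \<epsilon> "1/10" "hubs_graph r d"]] \<epsilon>
      unfolding S_def instopt_def by auto
    have S: "S \<ge> 1" using solves_space_pos[OF P rd] \<epsilon> by simp
    then have S1: "(real S)\<^sup>2 \<ge> 1" by simp
    have "real d \<le> 3675 * (real S)\<^sup>2"
    proof (cases "d \<ge> 4")
      case True
      then show ?thesis using solves_space_ge[OF P rd(1)] \<epsilon> by simp
    next
      case False
      then have "real d \<le> 4" by simp
      then show ?thesis using S1 by linarith
    qed
    \<comment> \<open>The constant 1/100 only requires 3675 \<le> 100^2, and it serves all
      \<epsilon> up to 1/20 alike.\<close>
    also have "\<dots> \<le> (100 * real S)\<^sup>2" by (simp add: power_mult_distrib)
    finally have "sqrt (real d) \<le> 100 * real S" by (intro real_le_lsqrt) auto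
    then show ?thesis by (simp add: S_def)
  qed
  show ?thesis
    by (rule exI[of _ "1/20"]) (use main in \<open>auto intro!: exI[of _ "1/100"]\<close>)
qed

end
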